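(* Let $F$ be a field of characteristic $0$ with algebraic closure $\overline F$, $K=F(t)$, and let $\delta$ be the derivation on $K$ with $\delta(t)=t$ and $\delta(a)=0$ for each $a\in F$. Let $0\neq P\in M_n(F)$ be a traceless matrix and let $\mathcal D_P(X)=\delta^c(X)+PX-XP$ for $X\in M_n(K)$. Let $S\subseteq\overline F$ be the set of eigenvalues of $P$ and let $k=\dim_{\mathbb Q}(\mathrm{span}_{\mathbb Q}(S\cup\{1\}))$. Let $(E,\delta_E)$ be a differential field extension of $(K,\delta)$ that splits the differential matrix algebra $(M_n(K),\mathcal D_P)$. (i) If $P$ is diagonalizable over $\overline F$, then $\mathrm{trdeg}_K(E)\geq k-1$. (ii) If $P$ is not diagonalizable over $\overline F$, then $\mathrm{trdeg}_K(E)\geq k$.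
   Context: For a differential field $(L,\delta_L)$, $\delta_L^c$ denotes the derivation of $M_n(L)$ obtained by applying $\delta_L$ to each matrix entry. A differential field extension $(E,\delta_E)$ of $(K,\delta)$ is a field extension $E\supseteq K$ with a derivation $\delta_E$ such that $\delta_E|_K=\delta$. It splits $(M_n(K),\mathcal D_P)$ if the base change $(M_n(E),\ X\mapsto\delta_E^c(X)+PX-XP)$ is isomorphic to $(M_n(E),\delta_E^c)$ by an $E$-algebra isomorphism commuting with the derivations. *)

theory Defs
  imports
    "HOL-Library.Extended_Nat"
    "HOL-Library.Poly_Mapping"
    "HOL-Computational_Algebra.Computational_Algebra"
    "HOL-Algebra.Algebraic_Closure_Type"
    "Jordan_Normal_Form.Char_Poly"
begin

section \<open>Rational vector spaces\<close>

instance alg_closure :: (field_char_0) field_char_0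
  by intro_classes (rule injI, metis to_ac_eq_iff of_nat_eq_iff to_ac_of_nat)

definition rat_scale :: "rat \<Rightarrow> 'a :: field_char_0 \<Rightarrow> 'a" where
  "rat_scale q x = of_rat q * x"

global_interpretation rat_vs: vector_space "rat_scale :: rat \<Rightarrow> 'a :: field_char_0 \<Rightarrow> 'a"
  by unfold_locales (simp_all add: rat_scale_def algebra_simps of_rat_add of_rat_mult)


section \<open>Transcendence degree\<close>

text \<open>
  A polynomial over \<^typ>\<open>'k\<close> whose variables are indexed by \<^typ>\<open>'v\<close> is an element of
  \<open>('v \<Rightarrow>\<^sub>0 nat) \<Rightarrow>\<^sub>0 'k\<close>, a finitely supported family of coefficients indexed by monomials.
  Below, the variables are indexed by the elements of the extension field, and each variable
  is evaluated at its index.  An extension of \<^typ>\<open>'k\<close> is given by its embedding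
  \<open>\<iota> :: 'k \<Rightarrow> 'e\<close>.
\<close>

definition eval_mpoly :: "('k \<Rightarrow> 'e) \<Rightarrow> (('e \<Rightarrow>\<^sub>0 nat) \<Rightarrow>\<^sub>0 'k :: field) \<Rightarrow> 'e :: field" where
  "eval_mpoly \<iota> p =
     (\<Sum>m \<in> Poly_Mapping.keys p. \<iota> (Poly_Mapping.lookup p m) *
       (\<Prod>x \<in> Poly_Mapping.keys m. x ^ Poly_Mapping.lookup m x))"

definition alg_independent :: "('k :: field \<Rightarrow> 'e :: field) \<Rightarrow> 'e set \<Rightarrow> bool" where
  "alg_independent \<iota> B \<longleftrightarrow>
     (\<forall>p. (\<forall>m \<in> Poly_Mapping.keys p. Poly_Mapping.keys m \<subseteq> B) \<longrightarrow> eval_mpoly \<iota> p = 0 \<longrightarrow> p = 0)"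

text \<open>
  The transcendence degree is the largest cardinality of an algebraically independent subset;
  all infinite cardinalities are identified with \<open>\<infinity>\<close>.
\<close>

definition trdeg :: "('k :: field \<Rightarrow> 'e :: field) \<Rightarrow> enat" where
  "trdeg \<iota> = (SUP B \<in> {B. alg_independent \<iota> B}. if finite B then enat (card B) else \<infinity>)"


section \<open>Differential fields and differential matrix algebras\<close>

definition derivation :: "('a :: field \<Rightarrow> 'a) \<Rightarrow> bool" where
  "derivation d \<longleftrightarrow>
     (\<forall>x y. d (x + y) = d x + d y) \<and> (\<forall>x y. d (x * y) = d x * y + x * d y)"

definition diff_field_ext ::
  "('k :: field \<Rightarrow> 'k) \<Rightarrow> ('e :: field \<Rightarrow> 'e) \<Rightarrow> ('k \<Rightarrow> 'e) \<Rightarrow> bool" where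
  "diff_field_ext d d' \<iota> \<longleftrightarrow>
     derivation d \<and> derivation d' \<and> field_hom \<iota> \<and> (\<forall>x. d' (\<iota> x) = \<iota> (d x))"

definition mat_derivation :: "('a :: field \<Rightarrow> 'a) \<Rightarrow> 'a mat \<Rightarrow> 'a mat \<Rightarrow> 'a mat" where
  "mat_derivation d P A = map_mat d A + P * A - A * P"

definition mat_algebra_iso :: "nat \<Rightarrow> ('a :: field mat \<Rightarrow> 'a mat) \<Rightarrow> bool" where
  "mat_algebra_iso n \<phi> \<longleftrightarrow>
     \<phi> \<in> ring_iso (ring_mat TYPE('a) n ()) (ring_mat TYPE('a) n ()) \<and>
     (\<forall>c. \<forall>A \<in> carrier_mat n n. \<phi> (c \<cdot>\<^sub>m A) = c \<cdot>\<^sub>m \<phi> A)"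

definition diff_mat_algebra_isomorphic ::
  "nat \<Rightarrow> ('a :: field mat \<Rightarrow> 'a mat) \<Rightarrow> ('a mat \<Rightarrow> 'a mat) \<Rightarrow> bool" where
  "diff_mat_algebra_isomorphic n D D' \<longleftrightarrow>
     (\<exists>\<phi>. mat_algebra_iso n \<phi> \<and> (\<forall>A \<in> carrier_mat n n. \<phi> (D A) = D' (\<phi> A)))"

text \<open>
  The extension \<open>\<iota>\<close> with derivation \<open>d'\<close> splits the algebra of \<open>n \<times> n\<close> matrices with
  the derivation \<open>mat_derivation d P\<close>; the base change of the latter is
  \<open>mat_derivation d' (map_mat \<iota> P)\<close>, so \<open>d\<close> itself does not occur.
\<close>

definition splits_mat_derivation ::
  "nat \<Rightarrow> 'k :: field mat \<Rightarrow> ('e :: field \<Rightarrow> 'e) \<Rightarrow> ('k \<Rightarrow> 'e) \<Rightarrow> bool" where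
  "splits_mat_derivation n P d' \<iota> \<longleftrightarrow>
     diff_mat_algebra_isomorphic n (mat_derivation d' (map_mat \<iota> P)) (map_mat d')"


section \<open>Rational functions and matrices\<close>

definition ratfun_const :: "'a :: field \<Rightarrow> 'a poly fract" where
  "ratfun_const a = to_fract [:a:]"

definition ratfun_var :: "'a :: field poly fract" where
  "ratfun_var = to_fract [:0, 1:]"

definition mat_trace :: "'a :: comm_monoid_add mat \<Rightarrow> 'a" where
  "mat_trace A = (\<Sum>i < dim_row A. A $$ (i, i))"

definition diagonalizable_mat :: "'a :: field mat \<Rightarrow> bool" where
  "diagonalizable_mat A \<longleftrightarrow> (\<exists>D. diagonal_mat D \<and> similar_mat A D)"

end

theory Submission
  imports Defs "HOL-Library.Product_Plus"
begin

text \<open>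
  Automorphisms of a matrix algebra are inner, so a splitting over \<open>E\<close> is the same as an invertible
  matrix \<open>G\<close> over \<open>E\<close> with \<open>G' = G (P + c)\<close> for some scalar \<open>c\<close> (\<open>splitting_solution\<close>).  Over the algebraic
  closure \<open>A\<close> of \<open>E\<close>, to which the derivation extends as \<open>D\<close> and in which \<open>F\<^sub>a\<^sub>c\<close> embeds as a field of
  constants, a nonzero coordinate \<open>y\<close> of \<open>G v\<close> for an eigenvector \<open>v\<close> of \<open>P\<close> with eigenvalue \<open>\<lambda>\<close> satisfies
  \<open>y' = (\<lambda> + c) y\<close>.  As \<open>P\<close> is traceless, \<open>det G\<close> has logarithmic derivative \<open>n c\<close>, and
  \<open>u = y\<^sup>n / det G\<close> satisfies \<open>u' = n \<lambda> u\<close>: it behaves like an exponential with exponent \<open>n \<lambda>\<close>, just as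
  \<open>t\<close> does with exponent \<open>1\<close>.  If \<open>P\<close> is not diagonalizable, a Jordan chain of length two provides in
  addition an element \<open>z\<close> with \<open>z' = 1\<close>, a logarithm.

  Exponentials with rationally independent exponents and a logarithm are algebraically independent.
  This is shown with derivations instead of with monomials.  Elements of \<open>A\<close> that are killed
  by a power of \<open>D - m\<close>, for a constant \<open>m\<close>, form the generalised weight space of \<open>m\<close>.  These spaces are
  independent and multiply additively, so for every additive map \<open>\<xi>\<close> on the weights there is a
  derivation of \<open>A\<close> that multiplies the weight space of \<open>m\<close> by \<open>\<xi> m\<close> (\<open>weight_derivation\<close>).  The
  coordinate functions with respect to a rational basis of the weights that contains \<open>1\<close> thus give
  \<open>k - 1\<close> derivations that vanish on \<open>F(t)\<close> and are diagonal on the exponentials; the nilpotent part of \<open>D\<close>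
  is one more, which detects \<open>z\<close> (\<open>weights_bound_trdeg\<close>).

  A derivation of \<open>A\<close> that vanishes on \<open>F(t)\<close> is determined by its values on a transcendence basis of \<open>E\<close>.
  Hence linearly independent derivations of this kind bound the transcendence degree of \<open>E\<close> from below
  (\<open>trdeg_ge_card_derivations\<close>), although the exponentials themselves need not lie in \<open>E\<close>.

  The two constructions in \<open>A\<close>, extending a derivation and embedding \<open>F\<^sub>a\<^sub>c\<close>, are instances of one
  statement about extending sections of ring homomorphisms (\<open>section_extension\<close>).
\<close>

section \<open>Extending sections of ring homomorphisms\<close>

definition subring_set :: "'t :: comm_ring_1 set \<Rightarrow> bool" where
  "subring_set G \<longleftrightarrow> 1 \<in> G \<and> (\<forall>x\<in>G. \<forall>y\<in>G. x - y \<in> G \<and> x * y \<in> G)"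

definition coeffs_in :: "'t :: zero set \<Rightarrow> 't poly \<Rightarrow> bool" where
  "coeffs_in G p \<longleftrightarrow> (\<forall>i. coeff p i \<in> G)"

lemma subring_setD:
  assumes "subring_set G"
  shows "0 \<in> G" "1 \<in> G" "x \<in> G \<Longrightarrow> - x \<in> G" "x \<in> G \<Longrightarrow> y \<in> G \<Longrightarrow> x + y \<in> G"
    "x \<in> G \<Longrightarrow> y \<in> G \<Longrightarrow> x - y \<in> G" "x \<in> G \<Longrightarrow> y \<in> G \<Longrightarrow> x * y \<in> G"
proof -
  show one: "1 \<in> G" and diff: "x \<in> G \<Longrightarrow> y \<in> G \<Longrightarrow> x - y \<in> G"
    and "x \<in> G \<Longrightarrow> y \<in> G \<Longrightarrow> x * y \<in> G" for x y
    using assms by (auto simp: subring_set_def)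
  show zero: "0 \<in> G" using diff[OF one one] by simp
  show neg: "x \<in> G \<Longrightarrow> - x \<in> G" for x using diff[OF zero] by force
  show "x \<in> G \<Longrightarrow> y \<in> G \<Longrightarrow> x + y \<in> G" for x y using diff[OF _ neg, of x y] by simp
qed

lemma subring_set_sum:
  "subring_set G \<Longrightarrow> (\<And>i. i \<in> I \<Longrightarrow> f i \<in> G) \<Longrightarrow> sum f I \<in> G"
  by (induction I rule: infinite_finite_induct) (auto intro: subring_setD)

lemma subring_set_of_nat: "subring_set G \<Longrightarrow> of_nat n \<in> G"
  by (induction n) (auto intro: subring_setD)

lemma subring_set_power: "subring_set G \<Longrightarrow> x \<in> G \<Longrightarrow> x ^ n \<in> G"
  by (induction n) (auto intro: subring_setD)

lemma coeffs_in_closed: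
  assumes "subring_set G"
  shows "coeffs_in G 1" "a \<in> G \<Longrightarrow> coeffs_in G (monom a n)"
    "coeffs_in G p \<Longrightarrow> coeffs_in G q \<Longrightarrow> coeffs_in G (p - q)"
    "coeffs_in G p \<Longrightarrow> coeffs_in G q \<Longrightarrow> coeffs_in G (p * q)"
    "a \<in> G \<Longrightarrow> coeffs_in G p \<Longrightarrow> coeffs_in G (smult a p)"
  using subring_setD[OF assms] assms
  by (auto simp: coeffs_in_def coeff_mult coeff_monom intro!: subring_set_sum)

text \<open>
  This is the reason why \<open>\<pi>\<close> stays injective when \<open>\<tau>\<close> is adjoined to \<open>G\<close>.  One step of pseudo-division
  by the minimal polynomial \<open>p\<close> of \<open>\<pi> \<tau>\<close> lowers the degree of \<open>f\<close> without leaving the subring and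
  multiplies the value at \<open>\<tau>\<close> by the leading coefficient of \<open>p\<close>, which can be cancelled.
\<close>

lemma minimal_poly_lifts_relations:
  fixes \<pi> :: "'t :: comm_ring_1 \<Rightarrow> 'a :: field"
  assumes "comm_ring_hom \<pi>" and G: "subring_set G"
    and inj: "\<And>g. g \<in> G \<Longrightarrow> \<pi> g = 0 \<Longrightarrow> g = 0"
    and p: "coeffs_in G p" "poly p \<tau> = 0"
    and cancel: "\<And>x. lead_coeff p * x = 0 \<Longrightarrow> x = 0"
    and min: "\<And>f. coeffs_in G f \<Longrightarrow> f \<noteq> 0 \<Longrightarrow> \<pi> (poly f \<tau>) = 0 \<Longrightarrow> degree p \<le> degree f"
    and f: "coeffs_in G f" "\<pi> (poly f \<tau>) = 0"
  shows "poly f \<tau> = 0"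
  using f
proof (induction "degree f" arbitrary: f rule: less_induct)
  case less
  interpret comm_ring_hom \<pi> by fact
  show ?case
  proof (cases "degree f = 0")
    case True
    then obtain a where "f = [:a:]" by (auto elim: degree_eq_zeroE)
    then show ?thesis using less.prems inj[of a] by (auto simp: coeffs_in_def coeff_pCons split: nat.splits)
  next
    case False
    let ?n = "degree f - degree p"
    have le: "degree p \<le> degree f" using min[of f] less.prems False by force
    define g where "g = smult (lead_coeff p) f - monom (lead_coeff f) ?n * p"
    have "degree (monom (lead_coeff f) ?n * p) \<le> degree f"
      using degree_mult_le[of "monom (lead_coeff f) ?n" p] degree_monom_le[of "lead_coeff f" ?n] le
      by linarith
    then have "degree g \<le> degree f"
      unfolding g_def by (intro degree_diff_le) (auto intro: degree_smult_le)
    moreover have "coeff g (degree f) = 0"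
      using le by (simp add: g_def coeff_monom_mult)
    ultimately have "degree g < degree f"
      using False leading_coeff_0_iff[of g] by (metis degree_0 order_le_imp_less_or_eq)
    moreover have "coeffs_in G g"
      using less.prems(1) p(1) G unfolding g_def
      by (intro coeffs_in_closed(2-5)) (auto simp: coeffs_in_def)
    moreover have g: "poly g \<tau> = lead_coeff p * poly f \<tau>"
      by (simp add: g_def p(2))
    moreover have "\<pi> (poly g \<tau>) = 0"
      using less.prems by (simp add: g hom_mult)
    ultimately have "poly g \<tau> = 0" using less.hyps by blast
    then show ?thesis using cancel g by metis
  qed
qed

definition adjoin :: "'t :: comm_ring_1 set \<Rightarrow> 't \<Rightarrow> 't set" where
  "adjoin G \<tau> = {poly f \<tau> | f. coeffs_in G f}"

lemma subring_set_adjoin: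
  assumes G: "subring_set G"
  shows "subring_set (adjoin G \<tau>)" "G \<subseteq> adjoin G \<tau>" "\<tau> \<in> adjoin G \<tau>"
proof -
  show "subring_set (adjoin G \<tau>)"
    unfolding subring_set_def
  proof (intro conjI ballI)
    show "1 \<in> adjoin G \<tau>"
      using coeffs_in_closed(1)[OF G] poly_1[of \<tau>] unfolding adjoin_def by (metis (mono_tags) mem_Collect_eq)
    fix x y assume "x \<in> adjoin G \<tau>" "y \<in> adjoin G \<tau>"
    then obtain f g where fg: "coeffs_in G f" "coeffs_in G g" "x = poly f \<tau>" "y = poly g \<tau>"
      by (auto simp: adjoin_def)
    then show "x - y \<in> adjoin G \<tau>" "x * y \<in> adjoin G \<tau>"
      using coeffs_in_closed(3,4)[OF G fg(1,2)] unfolding adjoin_def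
      by (auto simp flip: poly_diff poly_mult)
  qed
  show "G \<subseteq> adjoin G \<tau>"
  proof
    fix a assume "a \<in> G"
    then have "coeffs_in G [:a:]" "a = poly [:a:] \<tau>"
      using coeffs_in_closed(2)[OF G, of a 0] by (auto simp: monom_0)
    then show "a \<in> adjoin G \<tau>" unfolding adjoin_def by blast
  qed
  have "coeffs_in G (monom 1 1)" "\<tau> = poly (monom 1 1) \<tau>"
    using coeffs_in_closed(2)[OF G, of 1 1] subring_setD[OF G] by (auto simp: poly_monom)
  then show "\<tau> \<in> adjoin G \<tau>" unfolding adjoin_def by blast
qed

text \<open>
  Both extension problems below -- embedding an algebraic extension into an algebraically closed
  field and extending a derivation -- ask for a section \<open>s\<close> of a ring homomorphism
  \<open>\<pi>\<close> onto a field that is prescribed on a subring.  The image of \<open>s\<close> is a subring on which \<open>\<pi>\<close> is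
  injective, and Zorn's lemma produces a maximal one; it maps onto the field because one more
  element can always be adjoined.
\<close>

lemma section_extension:
  fixes \<pi> :: "'t :: comm_ring_1 \<Rightarrow> 'a :: field"
  assumes "comm_ring_hom \<pi>" and G0: "subring_set G0"
    and inj0: "\<And>g. g \<in> G0 \<Longrightarrow> \<pi> g = 0 \<Longrightarrow> g = 0"
    and lift: "\<And>G y. subring_set G \<Longrightarrow> G0 \<subseteq> G \<Longrightarrow> (\<And>g. g \<in> G \<Longrightarrow> \<pi> g = 0 \<Longrightarrow> g = 0) \<Longrightarrow>
       \<exists>\<tau>. \<pi> \<tau> = y \<and> (\<forall>f. coeffs_in G f \<longrightarrow> \<pi> (poly f \<tau>) = 0 \<longrightarrow> poly f \<tau> = 0)"
  shows "\<exists>s. comm_ring_hom s \<and> (\<forall>x. \<pi> (s x) = x) \<and> (\<forall>g\<in>G0. s (\<pi> g) = g)"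
proof -
  interpret comm_ring_hom \<pi> by fact
  define A where "A = {G. subring_set G \<and> G0 \<subseteq> G \<and> (\<forall>g\<in>G. \<pi> g = 0 \<longrightarrow> g = 0)}"
  have "\<exists>M\<in>A. \<forall>N\<in>A. M \<subseteq> N \<longrightarrow> N = M"
  proof (rule subset_Zorn_nonempty)
    show "A \<noteq> {}" using G0 inj0 by (auto simp: A_def)
    fix CC assume ne: "CC \<noteq> {}" and chain: "subset.chain A CC"
    have sub: "subring_set G" "G0 \<subseteq> G" "\<forall>g\<in>G. \<pi> g = 0 \<longrightarrow> g = 0" if "G \<in> CC" for G
      using chain that by (auto simp: subset.chain_def A_def)
    have "x - y \<in> \<Union>CC \<and> x * y \<in> \<Union>CC" if xy: "x \<in> \<Union>CC" "y \<in> \<Union>CC" for x y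
    proof -
      obtain G where G: "G \<in> CC" "x \<in> G" "y \<in> G"
        using xy chain unfolding subset_chain_def by blast
      then show ?thesis using subring_setD(5,6)[OF sub(1)[OF G(1)] G(2,3)] by blast
    qed
    then have "subring_set (\<Union>CC)"
      using sub(1) ne subring_setD(2) unfolding subring_set_def[of "\<Union>CC"] by fast
    moreover have "G0 \<subseteq> \<Union>CC" using ne sub(2) by blast
    moreover have "\<forall>g\<in>\<Union>CC. \<pi> g = 0 \<longrightarrow> g = 0" using sub(3) by blast
    ultimately show "\<Union>CC \<in> A" by (simp add: A_def)
  qed
  then obtain M where M: "subring_set M" "G0 \<subseteq> M" and injM: "\<And>g. g \<in> M \<Longrightarrow> \<pi> g = 0 \<Longrightarrow> g = 0"
    and max: "\<And>N. N \<in> A \<Longrightarrow> M \<subseteq> N \<Longrightarrow> N = M"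
    by (auto simp: A_def)
  have onto: "\<exists>g\<in>M. \<pi> g = y" for y
  proof -
    obtain \<tau> where \<tau>: "\<pi> \<tau> = y" and
      rel: "\<And>f. coeffs_in M f \<Longrightarrow> \<pi> (poly f \<tau>) = 0 \<Longrightarrow> poly f \<tau> = 0"
      using lift[OF M injM] by blast
    have "adjoin M \<tau> \<in> A"
      using subring_set_adjoin[OF M(1), of \<tau>] M(2) rel by (auto simp: adjoin_def A_def)
    then have "adjoin M \<tau> = M"
      using max subring_set_adjoin(2)[OF M(1)] by blast
    then show ?thesis using subring_set_adjoin(3)[OF M(1)] \<tau> by blast
  qed
  define s where "s y = (SOME g. g \<in> M \<and> \<pi> g = y)" for y
  have s: "s y \<in> M" "\<pi> (s y) = y" for y
    using onto[of y] unfolding s_def by (metis (mono_tags, lifting) someI_ex)+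
  have uniq: "g = h" if "g \<in> M" "h \<in> M" "\<pi> g = \<pi> h" for g h
    using injM[of "g - h"] subring_setD[OF M(1)] that by (simp add: hom_minus)
  note in_M = subring_setD[OF M(1)] s
  have "comm_ring_hom s"
    by unfold_locales (rule uniq; simp add: in_M hom_add hom_mult)+
  moreover have "s (\<pi> g) = g" if "g \<in> G0" for g
    using that M(2) by (intro uniq) (auto simp: s)
  ultimately show ?thesis using s(2) by blast
qed

lemma minimal_relation:
  assumes "coeffs_in G f" "f \<noteq> 0" "poly (map_poly \<pi> f) y = 0"
  obtains p where "coeffs_in G p" "p \<noteq> 0" "poly (map_poly \<pi> p) y = 0"
    "\<And>f. coeffs_in G f \<Longrightarrow> f \<noteq> 0 \<Longrightarrow> poly (map_poly \<pi> f) y = 0 \<Longrightarrow> degree p \<le> degree f"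
  using ex_has_least_nat[of "\<lambda>f. coeffs_in G f \<and> f \<noteq> 0 \<and> poly (map_poly \<pi> f) y = 0" f degree]
    assms by blast

section \<open>Embedding an algebraic closure into an algebraically closed field\<close>

instantiation prod :: (comm_ring_1, comm_ring_1) comm_ring_1
begin

definition times_prod :: "'a \<times> 'b \<Rightarrow> 'a \<times> 'b \<Rightarrow> 'a \<times> 'b" where
  "times_prod x y = (fst x * fst y, snd x * snd y)"

definition one_prod :: "'a \<times> 'b" where
  "one_prod = (1, 1)"

instance
  by standard
    (simp_all add: times_prod_def one_prod_def prod_eq_iff algebra_simps)

end

lemma fst_snd_ring_hom:
  "comm_ring_hom (fst :: 'a :: comm_ring_1 \<times> 'b :: comm_ring_1 \<Rightarrow> 'a)"
  "comm_ring_hom (snd :: 'a \<times> 'b \<Rightarrow> 'b)"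
  by (unfold_locales; simp add: times_prod_def one_prod_def)+

interpretation fst_hom: comm_ring_hom "fst :: 'a :: comm_ring_1 \<times> 'b :: comm_ring_1 \<Rightarrow> 'a"
  by (rule fst_snd_ring_hom)

interpretation snd_hom: comm_ring_hom "snd :: 'a :: comm_ring_1 \<times> 'b :: comm_ring_1 \<Rightarrow> 'b"
  by (rule fst_snd_ring_hom)

lemma fst_poly: "fst (poly p x) = poly (map_poly fst p) (fst x)"
  and snd_poly: "snd (poly p x) = poly (map_poly snd p) (snd x)"
  by simp_all

declare fst_hom.poly_map_poly [simp del] snd_hom.poly_map_poly [simp del]

lemma algebraic_nonzero_relation:
  fixes x :: "'f :: field alg_closure"
  assumes "x \<noteq> 0"
  obtains p :: "'f poly" where "poly (map_poly to_ac p) x = 0" "coeff p 0 \<noteq> 0"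
proof -
  obtain p0 :: "'f poly" where "p0 \<noteq> 0" "poly (map_poly to_ac p0) x = 0"
    using alg_closure_algebraic .
  then show ?thesis
  proof (induction p0)
    case (pCons a p0)
    show ?case
    proof (cases "a = 0")
      case True
      then show ?thesis using pCons assms by (cases "p0 = 0") (auto simp: map_poly_pCons)
    next
      case False
      then show ?thesis using pCons.prems that[of "pCons a p0"] by simp
    qed
  qed simp
qed

text \<open>
  The embedding is a section of the first projection from \<open>F\<^sub>a\<^sub>c \<times> E\<close>, prescribed on the graph of \<open>h\<close>.
  A new element \<open>y\<close> is paired with a root, in the algebraically closed field, of the polynomial that
  corresponds to its minimal polynomial.
\<close>

lemma alg_closure_embedding:
  fixes h :: "'f :: field \<Rightarrow> 'e :: alg_closed_field"
  assumes "field_hom h"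
  shows "\<exists>\<sigma> :: 'f alg_closure \<Rightarrow> 'e. field_hom \<sigma> \<and> (\<forall>a. \<sigma> (to_ac a) = h a)"
proof -
  interpret h: field_hom h by fact
  define \<psi> where "\<psi> a = (to_ac a, h a)" for a
  interpret \<psi>: comm_ring_hom \<psi>
    by unfold_locales (auto simp: \<psi>_def prod_eq_iff times_prod_def one_prod_def hom_distribs)
  have \<psi>_poly: "map_poly fst (map_poly \<psi> p) = map_poly to_ac p"
    "map_poly snd (map_poly \<psi> p) = map_poly h p" for p
    by (auto intro!: poly_eqI simp: coeff_map_poly \<psi>_def)
  have lift: "\<exists>\<tau>. fst \<tau> = y \<and> (\<forall>f. coeffs_in G f \<longrightarrow> fst (poly f \<tau>) = 0 \<longrightarrow> poly f \<tau> = 0)"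
    if G: "subring_set G" "range \<psi> \<subseteq> G"
      and inj: "\<And>g. g \<in> G \<Longrightarrow> fst g = 0 \<Longrightarrow> g = 0"
    for G and y :: "'f alg_closure"
  proof -
    have coeffs_\<psi>: "coeffs_in G (map_poly \<psi> p)" for p
      using G(2) by (auto simp: coeffs_in_def)
    \<comment> \<open>Every element is algebraic, so a nonzero one has a relation with nonzero constant term;
      the second component, too, satisfies this relation and therefore does not vanish.\<close>
    have snd_nonzero: "snd g \<noteq> 0" if g: "g \<in> G" "g \<noteq> 0" for g
    proof
      assume z: "snd g = 0"
      have "fst g \<noteq> 0" using inj g by blast
      then obtain p :: "'f poly" where p: "poly (map_poly to_ac p) (fst g) = 0" "coeff p 0 \<noteq> 0"
        by (rule algebraic_nonzero_relation)
      have "poly (map_poly \<psi> p) g \<in> G"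
        using coeffs_\<psi>[of p] g(1) G(1) unfolding poly_altdef coeffs_in_def
        by (intro subring_set_sum subring_setD(6) subring_set_power) auto
      moreover have "fst (poly (map_poly \<psi> p) g) = 0"
        using p by (simp add: fst_poly \<psi>_poly)
      ultimately have "poly (map_poly \<psi> p) g = 0" using inj by blast
      then have "poly (map_poly h p) (snd g) = 0"
        using snd_poly[of "map_poly \<psi> p" g] \<psi>_poly(2) by simp
      then show False
        using p(2) by (simp add: z poly_0_coeff_0)
    qed
    obtain p0 :: "'f poly" where "p0 \<noteq> 0" "poly (map_poly to_ac p0) y = 0"
      using alg_closure_algebraic .
    moreover from this(1) have "map_poly \<psi> p0 \<noteq> 0"
      using \<psi>_poly(1)[of p0] by auto
    ultimately obtain p where p: "coeffs_in G p" "p \<noteq> 0" "poly (map_poly fst p) y = 0"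
      and min: "\<And>f. coeffs_in G f \<Longrightarrow> f \<noteq> 0 \<Longrightarrow> poly (map_poly fst f) y = 0 \<Longrightarrow> degree p \<le> degree f"
      using minimal_relation[OF coeffs_\<psi>, of p0 fst y] \<psi>_poly by metis
    have lc: "lead_coeff p \<in> G" "lead_coeff p \<noteq> 0"
      using p by (auto simp: coeffs_in_def)
    have lc_fst: "fst (lead_coeff p) \<noteq> 0" and lc_snd: "snd (lead_coeff p) \<noteq> 0"
      using inj[OF lc(1)] snd_nonzero[OF lc(1)] lc(2) by blast+
    have "degree p > 0"
    proof (rule ccontr)
      assume "\<not> degree p > 0"
      then obtain a where "p = [:a:]" by (auto elim: degree_eq_zeroE)
      then show False using p(3) lc_fst by (simp add: fst_hom.map_poly_pCons_hom)
    qed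
    then have "degree (map_poly snd p) > 0"
      using lc_snd by (metis coeff_map_poly le_degree not_gr_zero not_le snd_zero)
    then obtain z where z: "poly (map_poly snd p) z = 0"
      using alg_closed_imp_poly_has_root by blast
    have "poly p (y, z) = 0"
      using p(3) z by (simp add: prod_eq_iff fst_poly snd_poly)
    moreover have "x = 0" if "lead_coeff p * x = 0" for x
      using that lc_fst lc_snd by (auto simp: times_prod_def prod_eq_iff)
    ultimately have "poly f (y, z) = 0" if "coeffs_in G f" "fst (poly f (y, z)) = 0" for f
      using minimal_poly_lifts_relations[OF fst_snd_ring_hom(1) G(1) inj p(1), of "(y, z)" f] that min
      by (auto simp: fst_poly)
    then show ?thesis by (intro exI[of _ "(y, z)"]) auto
  qed
  have sub: "subring_set (range \<psi>)"
    unfolding subring_set_def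
    by (auto simp flip: \<psi>.hom_minus \<psi>.hom_mult intro: range_eqI[of _ _ 1])
  have inj: "g = 0" if "g \<in> range \<psi>" "fst g = 0" for g
    using that by (auto simp: \<psi>_def prod_eq_iff)
  obtain s where s: "comm_ring_hom s" "\<forall>x. fst (s x) = x" "\<forall>g\<in>range \<psi>. s (fst g) = g"
    using section_extension[OF fst_snd_ring_hom(1) sub inj lift] by blast
  interpret s: comm_ring_hom s by fact
  have "field_hom (snd \<circ> s)"
    by unfold_locales (auto simp: hom_distribs)
  moreover have "(snd \<circ> s) (to_ac a) = h a" for a
    using s(3) by (auto simp: \<psi>_def)
  ultimately show ?thesis by blast
qed

section \<open>Extending derivations\<close>

text \<open>
  The dual numbers \<open>a + b \<epsilon>\<close> with \<open>\<epsilon>\<^sup>2 = 0\<close>.  A map \<open>d\<close> is a derivation exactly when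
  \<open>x \<mapsto> x + d x \<epsilon>\<close> is a ring homomorphism, so derivations are sections of \<open>re\<close>.
\<close>

datatype 'a dual = Dual (re: 'a) (im: 'a)

instantiation dual :: (comm_ring_1) comm_ring_1
begin

definition zero_dual :: "'a dual" where "zero_dual = Dual 0 0"
definition one_dual :: "'a dual" where "one_dual = Dual 1 0"
definition plus_dual :: "'a dual \<Rightarrow> 'a dual \<Rightarrow> 'a dual" where
  "plus_dual x y = Dual (re x + re y) (im x + im y)"
definition minus_dual :: "'a dual \<Rightarrow> 'a dual \<Rightarrow> 'a dual" where
  "minus_dual x y = Dual (re x - re y) (im x - im y)"
definition uminus_dual :: "'a dual \<Rightarrow> 'a dual" where
  "uminus_dual x = Dual (- re x) (- im x)"
definition times_dual :: "'a dual \<Rightarrow> 'a dual \<Rightarrow> 'a dual" where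
  "times_dual x y = Dual (re x * re y) (im x * re y + re x * im y)"

lemmas dual_defs = zero_dual_def one_dual_def plus_dual_def minus_dual_def uminus_dual_def
  times_dual_def

instance
  by standard (simp_all add: dual_defs dual.expand algebra_simps)

end

lemma dual_sel [simp]:
  "re 0 = 0" "im 0 = 0" "re 1 = 1" "im 1 = 0"
  "re (x + y) = re x + re y" "im (x + y) = im x + im y"
  "re (x - y) = re x - re y" "im (x - y) = im x - im y"
  "re (- x) = - re x" "im (- x) = - im x"
  "re (x * y) = re x * re y" "im (x * y) = im x * re y + re x * im y"
  for x y :: "'a :: comm_ring_1 dual"
  by (simp_all add: dual_defs)

lemma dual_eq_iff: "x = y \<longleftrightarrow> re x = re y \<and> im x = im y"
  by (metis dual.collapse)

lemma re_ring_hom: "comm_ring_hom (re :: 'a :: comm_ring_1 dual \<Rightarrow> 'a)"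
  by unfold_locales simp_all

interpretation re_hom: comm_ring_hom "re :: 'a :: comm_ring_1 dual \<Rightarrow> 'a"
  by (rule re_ring_hom)

lemma re_poly: "re (poly p x) = poly (map_poly re p) (re x)"
  by simp

declare re_hom.poly_map_poly [simp del]

lemma poly_dual:
  fixes p :: "'a :: idom dual poly"
  shows "poly p (Dual a b) =
    Dual (poly (map_poly re p) a) (poly (map_poly im p) a + b * poly (pderiv (map_poly re p)) a)"
  by (induction p) (auto simp: dual_eq_iff map_poly_pCons pderiv_pCons algebra_simps)

text \<open>
  A subring of the dual numbers on which \<open>re\<close> is injective is the graph of a derivation on a subring
  of the field.
\<close>

lemma derivation_extension:
  fixes G0 :: "'a :: field dual set"
  assumes char: "CHAR('a) = 0" and G0: "subring_set G0"
    and inj0: "\<And>g. g \<in> G0 \<Longrightarrow> re g = 0 \<Longrightarrow> g = 0"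
  shows "\<exists>d. derivation d \<and> (\<forall>g\<in>G0. d (re g) = im g)"
proof -
  have "\<exists>\<tau>. re \<tau> = y \<and> (\<forall>f. coeffs_in G f \<longrightarrow> re (poly f \<tau>) = 0 \<longrightarrow> poly f \<tau> = 0)"
    if G: "subring_set G" and inj: "\<And>g. g \<in> G \<Longrightarrow> re g = 0 \<Longrightarrow> g = 0" for G and y :: 'a
  proof (cases "\<exists>f. coeffs_in G f \<and> f \<noteq> 0 \<and> poly (map_poly re f) y = 0")
    case False
    \<comment> \<open>A transcendental element may be given any derivative.\<close>
    then have "poly f (Dual y 0) = 0" if "coeffs_in G f" "re (poly f (Dual y 0)) = 0" for f
      using that by (auto simp: re_poly)
    then show ?thesis by (intro exI[of _ "Dual y 0"]) auto
  next
    case True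
    then obtain p where p: "coeffs_in G p" "p \<noteq> 0" "poly (map_poly re p) y = 0"
      and min: "\<And>f. coeffs_in G f \<Longrightarrow> f \<noteq> 0 \<Longrightarrow> poly (map_poly re f) y = 0 \<Longrightarrow> degree p \<le> degree f"
      using minimal_relation by metis
    have lc: "lead_coeff p \<in> G" "lead_coeff p \<noteq> 0"
      using p by (auto simp: coeffs_in_def)
    have lc_re: "re (lead_coeff p) \<noteq> 0" using inj lc by blast
    have deg: "degree p > 0"
    proof (rule ccontr)
      assume "\<not> degree p > 0"
      then obtain a where "p = [:a:]" by (auto elim: degree_eq_zeroE)
      then show False using p(3) lc_re by (simp add: re_hom.map_poly_pCons_hom)
    qed
    \<comment> \<open>The formal derivative of \<open>p\<close>, spelled out because \<open>pderiv\<close> requires a ring without zero divisors.\<close>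
    define q where "q = (\<Sum>i\<le>degree p. monom (of_nat (Suc i) * coeff p (Suc i)) i)"
    have coeff_q: "coeff q i = of_nat (Suc i) * coeff p (Suc i)" for i
      by (cases "i \<le> degree p") (auto simp: q_def coeff_sum coeff_eq_0 simp del: of_nat_Suc)
    have "coeffs_in G q"
      using p(1) G unfolding coeffs_in_def coeff_q
      by (auto intro: subring_setD(6) subring_set_of_nat simp del: of_nat_Suc)
    moreover have q: "map_poly re q = pderiv (map_poly re p)"
      by (rule poly_eqI) (simp add: coeff_q coeff_pderiv re_hom.hom_of_nat del: of_nat_Suc)
    moreover have "q \<noteq> 0"
    proof
      assume "q = 0"
      then have "re (coeff q (degree p - 1)) = 0" by simp
      then show False
        using deg lc_re char
        by (simp add: coeff_q re_hom.hom_of_nat of_nat_eq_0_iff_char_dvd del: of_nat_Suc)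
    qed
    moreover have "degree q < degree p"
      using deg by (intro degree_lessI) (auto simp: coeff_q coeff_eq_0)
    ultimately have q_nz: "poly (pderiv (map_poly re p)) y \<noteq> 0"
      using min[of q] by auto
    \<comment> \<open>The derivative of \<open>y\<close> is forced by differentiating the relation \<open>p(y) = 0\<close>.\<close>
    define \<tau> where "\<tau> = Dual y (- poly (map_poly im p) y / poly (pderiv (map_poly re p)) y)"
    have "poly p \<tau> = 0"
      using p(3) q_nz unfolding \<tau>_def by (simp add: poly_dual dual_eq_iff)
    moreover have "x = 0" if "lead_coeff p * x = 0" for x
      using that lc_re by (auto simp: dual_eq_iff)
    ultimately have "poly f \<tau> = 0" if "coeffs_in G f" "re (poly f \<tau>) = 0" for f
      using minimal_poly_lifts_relations[OF re_ring_hom G inj p(1), of \<tau> f] that min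
      by (auto simp: \<tau>_def re_poly)
    then show ?thesis by (intro exI[of _ \<tau>]) (auto simp: \<tau>_def)
  qed
  then obtain s where s: "comm_ring_hom s" "\<forall>x. re (s x) = x" "\<forall>g\<in>G0. s (re g) = g"
    using section_extension[OF re_ring_hom G0 inj0] by auto
  interpret s: comm_ring_hom s by fact
  have "derivation (im \<circ> s)"
    using s(2) unfolding derivation_def by (auto simp: hom_distribs)
  then show ?thesis using s(3) by (intro exI[of _ "im \<circ> s"]) simp
qed

section \<open>Derivations\<close>

lemma derivationD:
  assumes "derivation d"
  shows "d (x + y) = d x + d y" "d (x * y) = d x * y + x * d y" "d 0 = 0" "d 1 = 0"
    "d (- x) = - d x" "d (x - y) = d x - d y"
proof -
  have add: "d (x + y) = d x + d y" and mult: "d (x * y) = d x * y + x * d y" for x y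
    using assms by (auto simp: derivation_def)
  show "d (x + y) = d x + d y" "d (x * y) = d x * y + x * d y" by (fact add, fact mult)
  show zero: "d 0 = 0" using add[of 0 0] by (metis add.right_neutral add_left_cancel)
  show "d 1 = 0" using mult[of 1 1] by (metis add_cancel_right_right mult_1 mult_1_right)
  show neg: "d (- x) = - d x" for x
    using add[of x "- x"] zero by (simp add: add_eq_0_iff)
  show "d (x - y) = d x - d y" using add[of x "- y"] neg[of y] by simp
qed

lemma derivation_sum:
  assumes "derivation d"
  shows "d (sum f I) = (\<Sum>i\<in>I. d (f i))"
  by (induction I rule: infinite_finite_induct) (simp_all add: derivationD[OF assms])

lemma derivation_power:
  assumes "derivation d"
  shows "d (x ^ n) = of_nat n * x ^ (n - 1) * d x"
proof (induction n)
  case (Suc n)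
  then show ?case by (cases n) (simp_all add: derivationD[OF assms] algebra_simps)
qed (simp add: derivationD[OF assms])

lemma derivation_divide:
  assumes "derivation d" "y \<noteq> 0"
  shows "d (x / y) = (d x * y - x * d y) / y\<^sup>2"
proof -
  have "d x = d (x / y) * y + x / y * d y"
    using derivationD(2)[OF assms(1), of "x / y" y] assms(2) by simp
  then show ?thesis using assms(2) by (simp add: field_simps power2_eq_square)
qed

lemma derivation_lincomb:
  assumes "\<And>i. i \<in> I \<Longrightarrow> derivation (d i)"
  shows "derivation (\<lambda>x. \<Sum>i\<in>I. c i * d i x)"
  unfolding derivation_def
proof (intro conjI allI)
  fix x y
  show "(\<Sum>i\<in>I. c i * d i (x + y)) = (\<Sum>i\<in>I. c i * d i x) + (\<Sum>i\<in>I. c i * d i y)"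
    unfolding sum.distrib[symmetric]
    by (intro sum.cong) (simp_all add: derivationD[OF assms] algebra_simps)
  show "(\<Sum>i\<in>I. c i * d i (x * y)) = (\<Sum>i\<in>I. c i * d i x) * y + x * (\<Sum>i\<in>I. c i * d i y)"
    unfolding sum_distrib_left sum_distrib_right sum.distrib[symmetric]
    by (intro sum.cong) (simp_all add: derivationD[OF assms] algebra_simps)
qed

lemma derivation_poly:
  assumes "derivation d"
  shows "d (poly p x) = poly (map_poly d p) x + poly (pderiv p) x * d x"
  by (induction p)
    (simp_all add: derivationD[OF assms] map_poly_pCons pderiv_pCons algebra_simps)

text \<open>
  Differentiating \<open>q(x) = 0\<close> gives \<open>q'(x) d x = 0\<close>.  If \<open>x\<close> is a multiple root, \<open>q'\<close> is a nonzero
  polynomial of smaller degree to which the same argument applies.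
\<close>

lemma derivation_algebraic:
  fixes d :: "'a :: field \<Rightarrow> 'a"
  assumes d: "derivation d" and char: "CHAR('a) = 0"
    and q: "q \<noteq> 0" "\<And>i. d (coeff q i) = 0" "poly q x = 0"
  shows "d x = 0"
  using q
proof (induction "degree q" arbitrary: q rule: less_induct)
  case less
  have "map_poly d q = 0"
    using less.prems(2) by (intro poly_eqI) (simp add: coeff_map_poly derivationD[OF d])
  then have "poly (pderiv q) x * d x = 0"
    using derivation_poly[OF d, of q x] less.prems(3) by (simp add: derivationD[OF d])
  moreover have "d x = 0" if root: "poly (pderiv q) x = 0"
  proof -
    have deg: "degree q \<noteq> 0"
      using less.prems(1,3) by (metis degree_eq_zeroE pCons_0_0 poly_const_conv)
    then obtain m where m: "degree q = Suc m" by (cases "degree q") auto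
    then have "coeff (pderiv q) m \<noteq> 0"
      using less.prems(1) char
      by (metis coeff_pderiv dvd_0_left_iff leading_coeff_0_iff mult_eq_0_iff nat.distinct(1)
          of_nat_eq_0_iff_char_dvd)
    then have "pderiv q \<noteq> 0" by auto
    moreover have "degree (pderiv q) < degree q"
      using deg degree_pderiv_le[of q] by linarith
    moreover have "d (coeff (pderiv q) i) = 0" for i
    proof -
      have "d (of_nat n) = 0" for n
        by (induction n) (simp_all add: derivationD[OF d])
      then show ?thesis
        by (simp add: coeff_pderiv derivationD[OF d] less.prems(2) del: of_nat_Suc)
    qed
    ultimately show ?thesis using less.hyps root by blast
  qed
  ultimately show ?case by auto
qed

section \<open>Generalised weight spaces of a derivation\<close>

text \<open>
  The inductive form of the condition \<open>(D - \<mu>)\<^sup>k x = 0\<close> for some \<open>k\<close>, which spares the exponents.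
\<close>

inductive gen_weight :: "('a :: field \<Rightarrow> 'a) \<Rightarrow> 'a \<Rightarrow> 'a \<Rightarrow> bool" for D \<mu> where
  zero: "gen_weight D \<mu> 0"
| step: "gen_weight D \<mu> (D x - \<mu> * x) \<Longrightarrow> gen_weight D \<mu> x"

lemma gen_weight_eigenvector: "D x = \<mu> * x \<Longrightarrow> gen_weight D \<mu> x"
  by (rule gen_weight.step) (simp add: gen_weight.zero)

context
  fixes D :: "'a :: field \<Rightarrow> 'a"
  assumes D: "derivation D"
begin

lemma gen_weight_step_rev: "gen_weight D \<mu> x \<Longrightarrow> gen_weight D \<mu> (D x - \<mu> * x)"
  by (erule gen_weight.cases) (simp_all add: derivationD[OF D] gen_weight.zero)

lemma gen_weight_add:
  "gen_weight D \<mu> x \<Longrightarrow> gen_weight D \<mu> y \<Longrightarrow> gen_weight D \<mu> (x + y)"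
proof (induction arbitrary: y rule: gen_weight.induct)
  case (step x)
  have "gen_weight D \<mu> (D x - \<mu> * x + (D y - \<mu> * y))"
    using step gen_weight_step_rev by blast
  then show ?case
    by (intro gen_weight.step[of D \<mu> "x + y"]) (simp add: derivationD[OF D] algebra_simps)
qed simp

lemma gen_weight_const_mult:
  assumes "D c = 0"
  shows "gen_weight D \<mu> x \<Longrightarrow> gen_weight D \<mu> (c * x)"
proof (induction rule: gen_weight.induct)
  case (step x)
  then show ?case
    by (intro gen_weight.step[of D \<mu> "c * x"]) (simp add: derivationD[OF D] assms algebra_simps)
qed (simp add: gen_weight.zero)

lemma gen_weight_uminus: "gen_weight D \<mu> x \<Longrightarrow> gen_weight D \<mu> (- x)"
  using gen_weight_const_mult[of "- 1"] by (simp add: derivationD[OF D])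

lemma gen_weight_mult:
  assumes "gen_weight D \<mu> x" "gen_weight D \<nu> y"
  shows "gen_weight D (\<mu> + \<nu>) (x * y)"
  using assms
proof (induction arbitrary: y rule: gen_weight.induct)
  case (step x)
  show ?case using step.prems
  proof (induction rule: gen_weight.induct)
    case (step y)
    have "gen_weight D (\<mu> + \<nu>) ((D x - \<mu> * x) * y + x * (D y - \<nu> * y))"
      using gen_weight_add[OF \<open>\<And>y. gen_weight D \<nu> y \<Longrightarrow> gen_weight D (\<mu> + \<nu>) ((D x - \<mu> * x) * y)\<close>
          step.IH] step.hyps gen_weight.step by blast
    then show ?case
      by (intro gen_weight.step[of D "\<mu> + \<nu>" "x * y"]) (simp add: derivationD[OF D] algebra_simps)
  qed (simp add: gen_weight.zero)
qed (simp add: gen_weight.zero)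

lemma gen_weight_shift:
  assumes "D \<mu> = 0" "D \<nu> = 0" "gen_weight D \<nu> x"
  shows "gen_weight D \<nu> (D x - \<mu> * x)"
proof -
  have "gen_weight D \<nu> (D x - \<nu> * x + (\<nu> - \<mu>) * x)"
    using assms
    by (intro gen_weight_add gen_weight_step_rev gen_weight_const_mult)
      (simp_all add: derivationD[OF D])
  then show ?thesis by (simp add: algebra_simps)
qed

lemma eigenvector_gen_weight_zero:
  assumes "D \<mu> = 0" "D \<nu> = 0" "\<mu> \<noteq> \<nu>"
  shows "gen_weight D \<nu> x \<Longrightarrow> D x = \<mu> * x \<Longrightarrow> x = 0"
proof (induction rule: gen_weight.induct)
  case (step x)
  have eq: "D x - \<nu> * x = (\<mu> - \<nu>) * x" using step.prems by (simp add: algebra_simps)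
  have "(\<mu> - \<nu>) * x = 0"
    using step.IH step.prems assms unfolding eq by (simp add: derivationD[OF D] algebra_simps)
  then show ?case using assms(3) by simp
qed simp

text \<open>
  Applying the locally nilpotent operator \<open>D - w m\<close> to a vanishing sum shortens the summand of
  weight \<open>w m\<close> and is injective on the others.
\<close>

lemma gen_weight_independent:
  assumes "finite M" "inj_on w M" "\<And>m. m \<in> M \<Longrightarrow> D (w m) = 0"
    "\<And>m. m \<in> M \<Longrightarrow> gen_weight D (w m) (x m)" "(\<Sum>m\<in>M. x m) = 0" "m \<in> M"
  shows "x m = 0"
  using assms
proof (induction M arbitrary: x m rule: finite_induct)
  case (insert a M)
  have const: "D (w m) = 0" if "m \<in> insert a M" for m using that insert.prems(2) by blast
  have distinct: "w a \<noteq> w m" if "m \<in> M" for m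
    using that insert.prems(1) insert.hyps(2) by (auto simp: inj_on_def)
  have vanish: "\<forall>m\<in>M. y m = 0"
    if "gen_weight D (w a) z" "\<forall>m\<in>M. gen_weight D (w m) (y m)" "z + (\<Sum>m\<in>M. y m) = 0" for z y
    using that
  proof (induction arbitrary: y rule: gen_weight.induct)
    case zero
    then show ?case using insert.IH[of y] insert.prems(1,2) by (simp add: inj_on_insert)
  next
    case (step z)
    define y' where "y' m = D (y m) - w a * y m" for m
    have "D z - w a * z + (\<Sum>m\<in>M. y' m) = D (z + (\<Sum>m\<in>M. y m)) - w a * (z + (\<Sum>m\<in>M. y m))"
      by (simp add: y'_def derivationD[OF D] derivation_sum[OF D] sum_subtractf sum_distrib_left
          algebra_simps)
    also have "\<dots> = 0" by (simp add: step.prems(2) derivationD[OF D])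
    finally have "\<forall>m\<in>M. y' m = 0"
      using step.IH[of y'] gen_weight_shift const step.prems(1) by (simp add: y'_def)
    then show ?case
      using eigenvector_gen_weight_zero[OF _ _ distinct] const step.prems(1) by (auto simp: y'_def)
  qed
  have sum: "x a + (\<Sum>m\<in>M. x m) = 0"
    using insert.prems(4) insert.hyps by simp
  have "\<forall>m\<in>M. x m = 0"
    by (rule vanish[of "x a"]) (use insert.prems(3) sum in blast)+
  moreover from this have "x a = 0" using sum by simp
  ultimately show ?case using insert.prems(5) by blast
qed simp

text \<open>
  Generalised weight spaces are independent and multiply additively in the weights.  So on the ring
  that they span, multiplying the weight space of \<open>\<sigma> m\<close> by \<open>\<sigma> (\<xi> m)\<close> is a well-defined derivation for
  every additive \<open>\<xi>\<close>, and it extends to the whole field.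
\<close>

lemma weight_derivation:
  fixes \<sigma> :: "'b :: field \<Rightarrow> 'a"
  assumes char: "CHAR('a) = 0" and "field_hom \<sigma>" and const: "\<And>m. D (\<sigma> m) = 0"
    and \<xi>: "\<And>m m'. \<xi> (m + m') = \<xi> m + \<xi> m'"
  shows "\<exists>d. derivation d \<and> (\<forall>m x. gen_weight D (\<sigma> m) x \<longrightarrow> d x = \<sigma> (\<xi> m) * x)"
proof -
  interpret \<sigma>: field_hom \<sigma> by fact
  define e where "e m x = Dual x (\<sigma> (\<xi> m) * x)" for m x
  have e_simps: "e m 0 = 0" "e m x - e m y = e m (x - y)" "e m x * e m' y = e (m + m') (x * y)"
    for m m' x y
    by (simp_all add: e_def dual_eq_iff \<xi> \<sigma>.hom_add algebra_simps)
  \<comment> \<open>The graph of the derivation on the sum of the weight spaces; the summands are indexed by all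
    \<open>m\<close> and vanish outside a finite set, so that sums of two elements need no case distinction.\<close>
  define G where "G = {g. \<exists>M x. finite M \<and> (\<forall>m. gen_weight D (\<sigma> m) (x m)) \<and>
    (\<forall>m. m \<notin> M \<longrightarrow> x m = 0) \<and> g = (\<Sum>m\<in>M. e m (x m))}"
  have gen: "e m x \<in> G" if "gen_weight D (\<sigma> m) x" for m x
    unfolding G_def using that
    by (intro CollectI exI[of _ "{m}"] exI[of _ "\<lambda>k. if k = m then x else 0"])
      (simp add: gen_weight.zero)
  have diff: "g - h \<in> G" if gh: "g \<in> G" "h \<in> G" for g h
  proof -
    obtain M x where g: "finite M" "\<forall>m. gen_weight D (\<sigma> m) (x m)" "\<forall>m. m \<notin> M \<longrightarrow> x m = 0"
      "g = (\<Sum>m\<in>M. e m (x m))" using gh(1) unfolding G_def by blast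
    obtain N y where h: "finite N" "\<forall>m. gen_weight D (\<sigma> m) (y m)" "\<forall>m. m \<notin> N \<longrightarrow> y m = 0"
      "h = (\<Sum>m\<in>N. e m (y m))" using gh(2) unfolding G_def by blast
    have "g = (\<Sum>m\<in>M \<union> N. e m (x m))" "h = (\<Sum>m\<in>M \<union> N. e m (y m))"
      unfolding g(4) h(4) using g(1,3) h(1,3)
      by (intro sum.mono_neutral_left; simp add: e_simps)+
    then have "g - h = (\<Sum>m\<in>M \<union> N. e m (x m - y m))"
      by (simp add: e_simps flip: sum_subtractf)
    moreover have "gen_weight D (\<sigma> m) (x m - y m)" for m
      using gen_weight_add[OF _ gen_weight_uminus, of "\<sigma> m" "x m" "y m"] g(2) h(2) by simp
    ultimately show ?thesis
      unfolding G_def using g(1,3) h(1,3)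
      by (intro CollectI exI[of _ "M \<union> N"] exI[of _ "\<lambda>m. x m - y m"]) auto
  qed
  have "e 0 0 \<in> G" by (rule gen) (rule gen_weight.zero)
  then have add: "g + h \<in> G" if "g \<in> G" "h \<in> G" for g h
    using diff[OF that(1) diff[OF _ that(2), of 0]] by (simp add: e_simps)
  have sum: "sum f I \<in> G" if "\<And>i. i \<in> I \<Longrightarrow> f i \<in> G" for f and I :: "'b set"
    using that \<open>e 0 0 \<in> G\<close>
    by (induction I rule: infinite_finite_induct) (simp_all add: e_simps add)
  have "subring_set G"
    unfolding subring_set_def
  proof (intro conjI ballI)
    have "e 0 1 \<in> G"
      by (rule gen) (simp add: gen_weight_eigenvector derivationD[OF D])
    moreover have "\<xi> 0 = 0" using \<xi>[of 0 0] by (metis add.right_neutral add_left_cancel)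
    ultimately show "1 \<in> G" by (simp add: e_def one_dual_def)
    fix g h assume gh: "g \<in> G" "h \<in> G"
    then show "g - h \<in> G" by (rule diff)
    obtain M x where g: "\<forall>m. gen_weight D (\<sigma> m) (x m)" "g = (\<Sum>m\<in>M. e m (x m))"
      using gh(1) unfolding G_def by blast
    obtain N y where h: "\<forall>m. gen_weight D (\<sigma> m) (y m)" "h = (\<Sum>m\<in>N. e m (y m))"
      using gh(2) unfolding G_def by blast
    show "g * h \<in> G"
      unfolding g(2) h(2) sum_product e_simps
      by (intro sum gen) (simp only: \<sigma>.hom_add gen_weight_mult g(1) h(1))
  qed
  moreover have "g = 0" if gG: "g \<in> G" "re g = 0" for g
  proof -
    obtain M x where g: "finite M" "\<forall>m. gen_weight D (\<sigma> m) (x m)" "g = (\<Sum>m\<in>M. e m (x m))"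
      using gG(1) unfolding G_def mem_Collect_eq by (elim exE conjE) (rule that)
    have "(\<Sum>m\<in>M. x m) = 0"
      using gG(2) unfolding g(3) re_hom.hom_sum by (simp add: e_def)
    moreover have "inj_on \<sigma> M"
      by (auto intro!: inj_onI simp: \<sigma>.eq_iff)
    ultimately have "\<forall>m\<in>M. x m = 0"
      using gen_weight_independent[OF g(1), of \<sigma> x] g(2) const by blast
    then show ?thesis unfolding g(3) by (simp add: e_simps)
  qed
  ultimately obtain d where "derivation d" and d: "\<forall>g\<in>G. d (re g) = im g"
    using derivation_extension[OF char] by blast
  moreover have "d x = \<sigma> (\<xi> m) * x" if "gen_weight D (\<sigma> m) x" for m x
    using bspec[OF d gen[OF that]] by (simp add: e_def)
  ultimately show ?thesis by blast
qed

end

section \<open>Derivations bound the transcendence degree from below\<close>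

lemma homogeneous_system:
  fixes a :: "'i \<Rightarrow> 'b \<Rightarrow> 'a :: field"
  assumes "finite I" "finite B" "card B < card I"
  shows "\<exists>c. (\<exists>i\<in>I. c i \<noteq> 0) \<and> (\<forall>b\<in>B. (\<Sum>i\<in>I. c i * a i b) = 0)"
proof -
  let ?n = "card I"
  obtain f where f: "bij_betw f {0..<?n} I" using ex_bij_betw_nat_finite[OF assms(1)] by blast
  obtain g where g: "bij_betw g {0..<card B} B" using ex_bij_betw_nat_finite[OF assms(2)] by blast
  \<comment> \<open>Padding the system with zero rows gives a singular square matrix.\<close>
  define A where "A = mat ?n ?n (\<lambda>(k, j). if k < card B then a (f j) (g k) else 0)"
  have A: "A \<in> carrier_mat ?n ?n" by (simp add: A_def)
  have "det (transpose_mat A) = 0"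
    unfolding det_0_iff_vec_prod_zero_field[OF transpose_carrier_mat[THEN iffD2, OF A]]
  proof (intro exI[of _ "unit_vec ?n (card B)"] conjI)
    show "unit_vec ?n (card B) \<noteq> (0\<^sub>v ?n :: 'a vec)"
      using assms(3) by (metis index_unit_vec(2) index_zero_vec(1) zero_neq_one)
    show "transpose_mat A *\<^sub>v unit_vec ?n (card B) = 0\<^sub>v ?n"
      using assms(3) by (intro eq_vecI) (auto simp: A_def)
  qed simp
  then have "det A = 0" using det_transpose[OF A] by simp
  then obtain v where v: "v \<in> carrier_vec ?n" "v \<noteq> 0\<^sub>v ?n" "A *\<^sub>v v = 0\<^sub>v ?n"
    using det_0_iff_vec_prod_zero_field[OF A] by blast
  define c where "c i = v $ the_inv_into {0..<?n} f i" for i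
  have inv: "the_inv_into {0..<?n} f (f j) = j" if "j < ?n" for j
    using that f by (intro the_inv_into_f_f) (auto simp: bij_betw_def)
  have "\<exists>j<?n. v $ j \<noteq> 0"
    using v(1,2) by (metis carrier_vecD eq_vecI index_zero_vec)
  then obtain j where "j < ?n" "v $ j \<noteq> 0" by blast
  then have "f j \<in> I" "c (f j) \<noteq> 0"
    using f inv by (auto simp: c_def bij_betw_def)
  moreover have "(\<Sum>i\<in>I. c i * a i b) = 0" if "b \<in> B" for b
  proof -
    have "b \<in> g ` {0..<card B}" using that g by (simp add: bij_betw_def)
    then obtain k where k: "k < card B" "b = g k" by auto
    have "(\<Sum>i\<in>I. c i * a i b) = (\<Sum>j = 0..<?n. c (f j) * a (f j) b)"
      using f by (intro sum.reindex_bij_betw[symmetric])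
    also have "\<dots> = (\<Sum>j = 0..<?n. a (f j) b * v $ j)"
      using inv by (intro sum.cong) (simp_all add: c_def)
    also have "\<dots> = (A *\<^sub>v v) $ k"
      using k assms(3) v(1) by (simp add: A_def scalar_prod_def)
    also have "\<dots> = 0" using k assms(3) v(3) by simp
    finally show ?thesis .
  qed
  ultimately show ?thesis by blast
qed

lemma prod_keys_cong:
  assumes "Poly_Mapping.keys m \<subseteq> A" "finite A"
  shows "(\<Prod>x\<in>Poly_Mapping.keys m. (x :: 'e :: field) ^ Poly_Mapping.lookup m x) =
    (\<Prod>x\<in>A. x ^ Poly_Mapping.lookup m x)"
  using assms by (intro prod.mono_neutral_left) (auto simp: in_keys_iff)

text \<open>
  A relation between \<open>x\<close> and an algebraically independent set \<open>B\<close> is regrouped by powers of \<open>x\<close>.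
  The new coefficients are polynomials in \<open>B\<close> and thus lie in \<open>Z\<close>, and one of them is nonzero because
  \<open>B\<close> is independent.
\<close>

lemma alg_dependent_imp_relation:
  fixes \<iota> :: "'k :: field \<Rightarrow> 'e :: field"
  assumes B: "alg_independent \<iota> B" and x: "\<not> alg_independent \<iota> (insert x B)"
    and Z: "subring_set Z" "range \<iota> \<subseteq> Z" "B \<subseteq> Z"
  obtains q where "q \<noteq> 0" "coeffs_in Z q" "poly q x = 0"
proof (cases "x \<in> Z")
  case True
  then show ?thesis
    using that[of "[:- x, 1:]"] subring_setD[OF Z(1)]
    by (auto simp: coeffs_in_def coeff_pCons split: nat.splits)
next
  case False
  then have "x \<notin> B" using Z(3) by blast
  obtain p where p: "\<And>m. m \<in> Poly_Mapping.keys p \<Longrightarrow> Poly_Mapping.keys m \<subseteq> insert x B"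
    "eval_mpoly \<iota> p = 0" "p \<noteq> 0"
    using x unfolding alg_independent_def by blast
  let ?deg = "\<lambda>m :: 'e \<Rightarrow>\<^sub>0 nat. Poly_Mapping.lookup m x"
  \<comment> \<open>A monomial \<open>m\<close> is split into the power of \<open>x\<close> and the remaining monomial \<open>r m\<close> in \<open>B\<close>.\<close>
  define r where "r m = m - Poly_Mapping.single x (?deg m)" for m
  have lookup_r: "Poly_Mapping.lookup (r m) y = (if y = x then 0 else Poly_Mapping.lookup m y)" for m y
    by (simp add: r_def lookup_minus lookup_single)
  have keys_r: "Poly_Mapping.keys (r m) = Poly_Mapping.keys m - {x}" for m
    by (auto simp: in_keys_iff lookup_r split: if_splits)
  have r_inj: "m = m'" if "r m = r m'" "?deg m = ?deg m'" for m m'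
    using that lookup_r by (intro poly_mapping_eqI) metis
  define c where "c m = \<iota> (Poly_Mapping.lookup p m) *
    (\<Prod>y\<in>Poly_Mapping.keys (r m). y ^ Poly_Mapping.lookup m y)" for m
  define q where "q = (\<Sum>m\<in>Poly_Mapping.keys p. monom (c m) (?deg m))"
  have "poly q x = eval_mpoly \<iota> p"
    unfolding q_def eval_mpoly_def poly_sum poly_monom
  proof (intro sum.cong refl)
    fix m assume "m \<in> Poly_Mapping.keys p"
    have "(\<Prod>y\<in>Poly_Mapping.keys m. y ^ Poly_Mapping.lookup m y) =
        (\<Prod>y\<in>insert x (Poly_Mapping.keys (r m)). y ^ Poly_Mapping.lookup m y)"
      by (rule prod_keys_cong) (auto simp: keys_r)
    also have "\<dots> = x ^ ?deg m * (\<Prod>y\<in>Poly_Mapping.keys (r m). y ^ Poly_Mapping.lookup m y)"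
      by (rule prod.insert) (auto simp: keys_r)
    finally show "c m * x ^ ?deg m = \<iota> (Poly_Mapping.lookup p m) *
        (\<Prod>y\<in>Poly_Mapping.keys m. y ^ Poly_Mapping.lookup m y)"
      by (simp add: c_def)
  qed
  then have "poly q x = 0" using p(2) by simp
  moreover have "coeffs_in Z q"
  proof -
    have "c m \<in> Z" if "m \<in> Poly_Mapping.keys p" for m
    proof -
      have prod: "prod f A \<in> Z" if "\<And>i. i \<in> A \<Longrightarrow> f i \<in> Z" for f and A :: "'e set"
        using that by (induction A rule: infinite_finite_induct) (auto intro: subring_setD[OF Z(1)])
      have "Poly_Mapping.keys (r m) \<subseteq> B" using p(1)[OF that] keys_r by blast
      then show ?thesis
        unfolding c_def using Z by (intro subring_setD(6) prod subring_set_power) auto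
    qed
    then show ?thesis
      unfolding coeffs_in_def q_def coeff_sum
      using subring_setD(1)[OF Z(1)] by (intro allI subring_set_sum[OF Z(1)]) simp
  qed
  moreover have "q \<noteq> 0"
  proof
    assume "q = 0"
    obtain m0 where m0: "m0 \<in> Poly_Mapping.keys p"
      using p(3) by (metis keys_eq_empty all_not_in_conv)
    \<comment> \<open>The coefficient of one power of \<open>x\<close>, as a polynomial \<open>s\<close> in the variables \<open>B\<close>.\<close>
    let ?M = "{m \<in> Poly_Mapping.keys p. ?deg m = ?deg m0}"
    define s where "s = (\<Sum>m\<in>?M. Poly_Mapping.single (r m) (Poly_Mapping.lookup p m))"
    have r_inj_on: "inj_on r ?M" using r_inj by (auto intro!: inj_onI)
    have lookup_s: "Poly_Mapping.lookup s (r m) = Poly_Mapping.lookup p m" if "m \<in> ?M" for m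
    proof -
      have "Poly_Mapping.lookup s (r m) = (\<Sum>m'\<in>?M. if m' = m then Poly_Mapping.lookup p m' else 0)"
        unfolding s_def lookup_sum lookup_single
        using r_inj_on that by (intro sum.cong refl) (auto simp: inj_on_def when_def)
      then show ?thesis using that by simp
    qed
    have keys_s: "Poly_Mapping.keys s = r ` ?M"
    proof (intro equalityI subsetI)
      fix k assume "k \<in> Poly_Mapping.keys s"
      then show "k \<in> r ` ?M"
        unfolding s_def using keys_sum[of "\<lambda>m. Poly_Mapping.single (r m) (Poly_Mapping.lookup p m)" ?M]
        by (fastforce split: if_splits)
    next
      fix k assume "k \<in> r ` ?M"
      then show "k \<in> Poly_Mapping.keys s"
        using lookup_s by (auto simp: in_keys_iff)
    qed
    have "eval_mpoly \<iota> s = (\<Sum>m\<in>?M. \<iota> (Poly_Mapping.lookup s (r m)) *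
        (\<Prod>y\<in>Poly_Mapping.keys (r m). y ^ Poly_Mapping.lookup (r m) y))"
      unfolding eval_mpoly_def keys_s by (rule sum.reindex_cong[OF r_inj_on refl]) simp
    also have "\<dots> = (\<Sum>m\<in>?M. c m)"
      using lookup_s by (intro sum.cong refl arg_cong2[of _ _ _ _ "(*)"] prod.cong)
        (auto simp: c_def lookup_r keys_r intro!: prod.cong)
    also have "\<dots> = coeff q (?deg m0)"
      unfolding q_def coeff_sum coeff_monom
      by (intro sum.mono_neutral_cong_left) auto
    also have "\<dots> = 0" using \<open>q = 0\<close> by simp
    finally have "eval_mpoly \<iota> s = 0" .
    moreover have "\<forall>k\<in>Poly_Mapping.keys s. Poly_Mapping.keys k \<subseteq> B"
      unfolding keys_s using p(1) keys_r by blast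
    ultimately have "s = 0" using B unfolding alg_independent_def by blast
    then show False using lookup_s[of m0] m0 by (simp add: in_keys_iff)
  qed
  ultimately show ?thesis using that by blast
qed

lemma alg_independent_empty:
  fixes \<iota> :: "'k :: field \<Rightarrow> 'e :: field"
  assumes "\<And>a. \<iota> a = 0 \<Longrightarrow> a = 0"
  shows "alg_independent \<iota> {}"
  unfolding alg_independent_def
proof (intro allI impI)
  fix p :: "('e \<Rightarrow>\<^sub>0 nat) \<Rightarrow>\<^sub>0 'k"
  assume *: "\<forall>m\<in>Poly_Mapping.keys p. Poly_Mapping.keys m \<subseteq> {}" "eval_mpoly \<iota> p = 0"
  then have keys: "Poly_Mapping.keys p \<subseteq> {0}" by auto
  then have "eval_mpoly \<iota> p = (\<Sum>m\<in>{0}. \<iota> (Poly_Mapping.lookup p m)) \<or> p = 0"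
    unfolding eval_mpoly_def by (cases "Poly_Mapping.keys p = {}") (auto simp: subset_singleton_iff)
  then have "p = 0 \<or> Poly_Mapping.lookup p 0 = 0" using *(2) assms by auto
  then show "p = 0"
    using keys by (metis in_keys_iff keys_eq_empty subset_singletonD singletonI)
qed

text \<open>
  A derivation of the algebraic closure that vanishes on the base field and on a maximal
  algebraically independent subset \<open>B\<close> of \<open>E\<close> is zero.  Hence the given derivations, which are
  linearly independent, cannot outnumber \<open>B\<close>: otherwise a nontrivial combination of
  them would vanish on \<open>B\<close>.
\<close>

lemma trdeg_ge_card_derivations:
  fixes \<iota> :: "'k :: field \<Rightarrow> 'e :: field" and d :: "'i \<Rightarrow> 'e alg_closure \<Rightarrow> 'e alg_closure"
  assumes char: "CHAR('e) = 0" and \<iota>: "field_hom \<iota>" and I: "finite I"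
    and d: "\<And>i. i \<in> I \<Longrightarrow> derivation (d i)"
    and base: "\<And>i a. i \<in> I \<Longrightarrow> d i (to_ac (\<iota> a)) = 0"
    and diag: "\<And>i. i \<in> I \<Longrightarrow> d i (u i) \<noteq> 0"
    and off_diag: "\<And>i j. i \<in> I \<Longrightarrow> j \<in> I \<Longrightarrow> i \<noteq> j \<Longrightarrow> d i (u j) = 0"
  shows "trdeg \<iota> \<ge> enat (card I)"
proof (rule ccontr)
  interpret \<iota>: field_hom \<iota> by fact
  assume "\<not> trdeg \<iota> \<ge> enat (card I)"
  then have lt: "trdeg \<iota> < enat (card I)" by simp
  have small: "finite B \<and> card B < card I" if "alg_independent \<iota> B" for B
  proof -
    have "(if finite B then enat (card B) else \<infinity>) \<le> trdeg \<iota>"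
      unfolding trdeg_def using that by (intro SUP_upper) simp
    then show ?thesis using lt by (cases "finite B") (auto dest: order_le_less_trans)
  qed
  have "alg_independent \<iota> {}" by (rule alg_independent_empty) simp
  then obtain B where B: "alg_independent \<iota> B"
    and max: "\<And>B'. alg_independent \<iota> B' \<Longrightarrow> card B' \<le> card B"
    using ex_has_greatest_nat[of "alg_independent \<iota>" "{}" card "card I"] small
    by (metis less_imp_le_nat)
  obtain c i where ci: "i \<in> I" "c i \<noteq> 0"
    and c: "\<And>b. b \<in> B \<Longrightarrow> (\<Sum>i\<in>I. c i * d i (to_ac b)) = 0"
    using homogeneous_system[OF I, of B "\<lambda>i b. d i (to_ac b)"] small[OF B] by blast
  define D where "D x = (\<Sum>i\<in>I. c i * d i x)" for x
  have D: "derivation D" unfolding D_def by (rule derivation_lincomb) (rule d)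
  have vanish_E: "D (to_ac x) = 0" for x
  proof -
    let ?Z = "{z. D (to_ac z) = 0}"
    have "subring_set ?Z" by (simp add: subring_set_def derivationD[OF D])
    moreover have "D (to_ac (\<iota> a)) = 0" for a
      unfolding D_def by (intro sum.neutral ballI) (simp add: base)
    then have "range \<iota> \<subseteq> ?Z" by blast
    moreover have "B \<subseteq> ?Z" using c unfolding D_def by blast
    ultimately have Z: "subring_set ?Z" "range \<iota> \<subseteq> ?Z" "B \<subseteq> ?Z" .
    show ?thesis
    proof (cases "x \<in> B")
      case False
      have "\<not> alg_independent \<iota> (insert x B)"
        using max[of "insert x B"] False small[OF B] by auto
      then obtain q where q: "q \<noteq> 0" "coeffs_in ?Z q" "poly q x = 0"
        using alg_dependent_imp_relation[OF B _ Z] by blast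
      interpret ac: field_hom "to_ac :: 'e \<Rightarrow> _" by unfold_locales simp_all
      have "map_poly to_ac q \<noteq> 0" using q(1) by simp
      moreover have "D (coeff (map_poly to_ac q) i) = 0" for i
        using q(2) by (simp add: coeffs_in_def)
      moreover have "poly (map_poly to_ac q) (to_ac x) = 0"
        using q(3) by simp
      ultimately show ?thesis
        using derivation_algebraic[OF D, of "map_poly to_ac q" "to_ac x"] char by simp
    qed (use Z in auto)
  qed
  have "D x = 0" for x
  proof -
    obtain q :: "'e poly" where "q \<noteq> 0" "poly (map_poly to_ac q) x = 0"
      using alg_closure_algebraic .
    then show ?thesis
      using derivation_algebraic[OF D, of "map_poly to_ac q" x] char vanish_E
      by (simp add: coeff_map_poly)
  qed
  then have "(\<Sum>j\<in>I. c j * d j (u i)) = 0" unfolding D_def by blast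
  moreover have "(\<Sum>j\<in>I. c j * d j (u i)) = c i * d i (u i)"
    using I ci(1) off_diag by (subst sum.remove[OF I ci(1)]) (simp add: sum.neutral)
  ultimately show False using ci diag by simp
qed

section \<open>Matrices with a derivation\<close>

lemma mat_eq_by_vec:
  assumes "A \<in> carrier_mat n m" "B \<in> carrier_mat n m"
    and "\<And>x. x \<in> carrier_vec m \<Longrightarrow> A *\<^sub>v x = B *\<^sub>v (x :: 'a :: field vec)"
  shows "A = B"
proof (rule eq_matI)
  fix i j assume ij: "i < dim_row B" "j < dim_col B"
  have "A *\<^sub>v unit_vec m j = B *\<^sub>v unit_vec m j" by (rule assms(3)) simp
  then have "(A *\<^sub>v unit_vec m j) $ i = (B *\<^sub>v unit_vec m j) $ i" by simp
  then show "A $$ (i, j) = B $$ (i, j)"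
    using ij assms(1,2) by (simp add: scalar_prod_right_unit)
qed (use assms in auto)

lemma linear_map_matrix:
  fixes f :: "'a :: field vec \<Rightarrow> 'a vec"
  assumes carrier: "\<And>x. x \<in> carrier_vec n \<Longrightarrow> f x \<in> carrier_vec m"
    and add: "\<And>x y. x \<in> carrier_vec n \<Longrightarrow> y \<in> carrier_vec n \<Longrightarrow> f (x + y) = f x + f y"
    and smult: "\<And>c x. x \<in> carrier_vec n \<Longrightarrow> f (c \<cdot>\<^sub>v x) = c \<cdot>\<^sub>v f x"
  shows "\<exists>G\<in>carrier_mat m n. \<forall>x\<in>carrier_vec n. f x = G *\<^sub>v x"
proof -
  define G where "G = mat m n (\<lambda>(a, i). f (unit_vec n i) $ a)"
  have "f x = G *\<^sub>v x" if x: "x \<in> carrier_vec n" for x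
  proof -
    define trunc where "trunc k = vec n (\<lambda>i. if i < k then x $ i else 0)" for k
    have "f (trunc k) = vec m (\<lambda>a. \<Sum>i<k. f (unit_vec n i) $ a * x $ i)" if "k \<le> n" for k
      using that
    proof (induction k)
      case 0
      have "trunc 0 = 0 \<cdot>\<^sub>v trunc 0" by (auto simp: trunc_def)
      then have "f (trunc 0) = 0 \<cdot>\<^sub>v f (trunc 0)"
        using smult[of "trunc 0" 0] by (simp add: trunc_def)
      also have "\<dots> = vec m (\<lambda>a. \<Sum>i<0. f (unit_vec n i) $ a * x $ i)"
        using carrier[of "trunc 0"] by (intro eq_vecI) (auto simp: trunc_def)
      finally show ?case .
    next
      case (Suc k)
      have "trunc (Suc k) = trunc k + x $ k \<cdot>\<^sub>v unit_vec n k"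
        using Suc.prems by (intro eq_vecI) (auto simp: trunc_def less_Suc_eq)
      then have "f (trunc (Suc k)) = f (trunc k) + x $ k \<cdot>\<^sub>v f (unit_vec n k)"
        using Suc.prems by (simp add: add smult trunc_def)
      then show ?case
        using Suc carrier[of "unit_vec n k"] by (intro eq_vecI) (auto simp: mult.commute)
    qed
    moreover have "trunc n = x" using x by (intro eq_vecI) (auto simp: trunc_def)
    ultimately have "f x = vec m (\<lambda>a. \<Sum>i<n. f (unit_vec n i) $ a * x $ i)" by blast
    also have "\<dots> = G *\<^sub>v x"
      using x by (intro eq_vecI) (auto simp: G_def scalar_prod_def atLeast0LessThan)
    finally show ?thesis .
  qed
  moreover have "G \<in> carrier_mat m n" by (simp add: G_def)
  ultimately show ?thesis by blast
qed

lemma mat_algebra_isoD: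
  fixes \<phi> :: "'a :: field mat \<Rightarrow> 'a mat"
  assumes "mat_algebra_iso n \<phi>"
  shows "A \<in> carrier_mat n n \<Longrightarrow> \<phi> A \<in> carrier_mat n n"
    "A \<in> carrier_mat n n \<Longrightarrow> B \<in> carrier_mat n n \<Longrightarrow> \<phi> (A * B) = \<phi> A * \<phi> B"
    "A \<in> carrier_mat n n \<Longrightarrow> B \<in> carrier_mat n n \<Longrightarrow> \<phi> (A + B) = \<phi> A + \<phi> B"
    "A \<in> carrier_mat n n \<Longrightarrow> \<phi> (c \<cdot>\<^sub>m A) = c \<cdot>\<^sub>m \<phi> A"
    "inj_on \<phi> (carrier_mat n n)"
  using assms unfolding mat_algebra_iso_def ring_iso_def Ring.ring_hom_def
  by (auto simp: ring_mat_def bij_betw_def)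

text \<open>
  Write \<open>x e\<^sub>0\<^sup>T\<close> for the matrix with first column \<open>x\<close> and zeros elsewhere.  For a suitable vector \<open>v\<close>
  the map \<open>x \<mapsto> \<phi> (x e\<^sub>0\<^sup>T) v\<close> is linear, nonzero and intertwines \<open>A\<close> with \<open>\<phi> A\<close>, because
  \<open>A (x e\<^sub>0\<^sup>T) = (A x) e\<^sub>0\<^sup>T\<close>.  Its kernel is invariant under all matrices, hence trivial.
\<close>

lemma mat_automorphism_inner:
  fixes \<phi> :: "'a :: field mat \<Rightarrow> 'a mat"
  assumes \<phi>: "mat_algebra_iso n \<phi>" and n: "n > 0"
  obtains G where "G \<in> carrier_mat n n" "det G \<noteq> 0"
    "\<And>A. A \<in> carrier_mat n n \<Longrightarrow> \<phi> A * G = G * A"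
proof -
  note \<phi>D = mat_algebra_isoD[OF \<phi>]
  define M where "M x = mat n n (\<lambda>(i, j). if j = 0 then x $ i else 0)" for x :: "'a vec"
  have M: "M x \<in> carrier_mat n n" for x by (simp add: M_def)
  have M_mult: "A * M x = M (A *\<^sub>v x)" if "A \<in> carrier_mat n n" "x \<in> carrier_vec n" for A x
    using that by (intro eq_matI) (auto simp: M_def scalar_prod_def)
  let ?e = "unit_vec n 0 :: 'a vec"
  have "\<phi> (M ?e) \<noteq> 0\<^sub>m n n"
  proof
    assume "\<phi> (M ?e) = 0\<^sub>m n n"
    moreover have "\<phi> (0 \<cdot>\<^sub>m M ?e) = 0 \<cdot>\<^sub>m \<phi> (M ?e)" by (rule \<phi>D(4)[OF M])
    moreover have "0 \<cdot>\<^sub>m \<phi> (M ?e) = 0\<^sub>m n n"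
      using carrier_matD[OF \<phi>D(1)[OF M, of ?e]] by (intro eq_matI) simp_all
    ultimately have "M ?e = 0 \<cdot>\<^sub>m M ?e"
      using inj_onD[OF \<phi>D(5), of "M ?e" "0 \<cdot>\<^sub>m M ?e"] M by simp
    then have "M ?e $$ (0, 0) = (0 \<cdot>\<^sub>m M ?e) $$ (0, 0)" by simp
    then show False using n by (simp add: M_def)
  qed
  then obtain v where v: "v \<in> carrier_vec n" "\<phi> (M ?e) *\<^sub>v v \<noteq> 0\<^sub>v n"
    using mat_eq_by_vec[OF \<phi>D(1)[OF M] zero_carrier_mat, of ?e] by force
  have image_carrier: "\<phi> (M x) *\<^sub>v v \<in> carrier_vec n" for x
    by (rule mult_mat_vec_carrier[OF \<phi>D(1)[OF M] v(1)])
  have image_add: "\<phi> (M (x + y)) *\<^sub>v v = \<phi> (M x) *\<^sub>v v + \<phi> (M y) *\<^sub>v v"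
    if "x \<in> carrier_vec n" "y \<in> carrier_vec n" for x y
  proof -
    have "M (x + y) = M x + M y" using that by (intro eq_matI) (auto simp: M_def)
    then show ?thesis
      using \<phi>D(3)[OF M M] add_mult_distrib_mat_vec[OF \<phi>D(1)[OF M] \<phi>D(1)[OF M] v(1)] by simp
  qed
  have image_smult: "\<phi> (M (c \<cdot>\<^sub>v x)) *\<^sub>v v = c \<cdot>\<^sub>v (\<phi> (M x) *\<^sub>v v)"
    if "x \<in> carrier_vec n" for c x
  proof -
    have "M (c \<cdot>\<^sub>v x) = c \<cdot>\<^sub>m M x" using that by (intro eq_matI) (auto simp: M_def)
    then show ?thesis
      using \<phi>D(4)[OF M] carrier_matD[OF \<phi>D(1)[OF M, of x]] v(1) by (intro eq_vecI) auto
  qed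
  have "\<exists>G\<in>carrier_mat n n. \<forall>x\<in>carrier_vec n. \<phi> (M x) *\<^sub>v v = G *\<^sub>v x"
    by (intro linear_map_matrix image_carrier image_add image_smult)
  then obtain G where G: "G \<in> carrier_mat n n"
    "\<And>x. x \<in> carrier_vec n \<Longrightarrow> \<phi> (M x) *\<^sub>v v = G *\<^sub>v x"
    by blast
  have intertwine: "\<phi> A *\<^sub>v (G *\<^sub>v x) = G *\<^sub>v (A *\<^sub>v x)"
    if A: "A \<in> carrier_mat n n" and x: "x \<in> carrier_vec n" for A x
  proof -
    have "\<phi> A *\<^sub>v (G *\<^sub>v x) = \<phi> A * \<phi> (M x) *\<^sub>v v"
      using assoc_mult_mat_vec[OF \<phi>D(1)[OF A] \<phi>D(1)[OF M] v(1)] G(2)[OF x] by simp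
    also have "\<dots> = \<phi> (M (A *\<^sub>v x)) *\<^sub>v v"
      using \<phi>D(2)[OF A M, of x] M_mult[OF A x] by simp
    also have "\<dots> = G *\<^sub>v (A *\<^sub>v x)" by (rule G(2)) (use A x in simp)
    finally show ?thesis .
  qed
  have "\<phi> A * G = G * A" if A: "A \<in> carrier_mat n n" for A
  proof (rule mat_eq_by_vec)
    fix x :: "'a vec" assume x: "x \<in> carrier_vec n"
    show "\<phi> A * G *\<^sub>v x = G * A *\<^sub>v x"
      using intertwine[OF A x] assoc_mult_mat_vec[OF \<phi>D(1)[OF A] G(1) x]
        assoc_mult_mat_vec[OF G(1) A x] by simp
  qed (use \<phi>D(1)[OF A] G(1) A in auto)
  moreover have "det G \<noteq> 0"
  proof
    assume "det G = 0"
    then obtain x where x: "x \<in> carrier_vec n" "x \<noteq> 0\<^sub>v n" "G *\<^sub>v x = 0\<^sub>v n"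
      using det_0_iff_vec_prod_zero_field[OF G(1)] by blast
    then obtain i where i: "i < n" "x $ i \<noteq> 0"
      by (metis carrier_vecD eq_vecI index_zero_vec)
    define A where "A = mat n n (\<lambda>(a, b). if a = 0 \<and> b = i then 1 / x $ i else 0)"
    have A: "A \<in> carrier_mat n n" by (simp add: A_def)
    have "A *\<^sub>v x = ?e"
      using x(1) i n by (intro eq_vecI) (auto simp: A_def scalar_prod_def if_distrib[of "\<lambda>c. c * _"] cong: if_cong)
    then have "G *\<^sub>v ?e = \<phi> A *\<^sub>v 0\<^sub>v n" using intertwine[OF A x(1)] x(3) by simp
    also have "\<dots> = 0\<^sub>v n" using \<phi>D(1)[OF A] by (intro eq_vecI) auto
    finally show False using v(2) G(2)[of ?e] by simp
  qed
  ultimately show ?thesis using that G(1) by blast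
qed

lemma commutes_with_all_imp_scalar:
  fixes K :: "'a :: field mat"
  assumes K: "K \<in> carrier_mat n n" and n: "n > 0"
    and comm: "\<And>A. A \<in> carrier_mat n n \<Longrightarrow> K * A = A * K"
  obtains c where "K = c \<cdot>\<^sub>m 1\<^sub>m n"
proof
  define U :: "nat \<Rightarrow> nat \<Rightarrow> 'a mat" where "U i j = mat n n (\<lambda>(a, b). if a = i \<and> b = j then 1 else 0)" for i j
  have U: "U i j \<in> carrier_mat n n" for i j by (simp add: U_def)
  have KU: "(K * U i j) $$ (a, j) = K $$ (a, i)" if "i < n" "j < n" "a < n" for a i j
    using that K by (simp add: U_def scalar_prod_def if_distrib[of "\<lambda>c. _ * c"] cong: if_cong)
  have UK: "(U i j * K) $$ (a, b) = (if a = i then K $$ (j, b) else 0)"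
    if "i < n" "j < n" "a < n" "b < n" for a b i j
    using that K by (simp add: U_def scalar_prod_def if_distrib[of "\<lambda>c. c * _"] cong: if_cong)
  have entry: "K $$ (a, i) = (if a = i then K $$ (j, j) else 0)" if "i < n" "j < n" "a < n" for a i j
    using KU[OF that] UK[OF that(1,2,3,2)] comm[OF U, of i j] by simp
  show "K = K $$ (0, 0) \<cdot>\<^sub>m 1\<^sub>m n"
  proof (rule eq_matI)
    fix a i assume "a < dim_row (K $$ (0, 0) \<cdot>\<^sub>m 1\<^sub>m n)" "i < dim_col (K $$ (0, 0) \<cdot>\<^sub>m 1\<^sub>m n)"
    then have "a < n" "i < n" by simp_all
    from entry[OF this(2) n this(1)] this
    show "K $$ (a, i) = (K $$ (0, 0) \<cdot>\<^sub>m 1\<^sub>m n) $$ (a, i)"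
      by (cases "a = i") simp_all
  qed (use K in simp_all)
qed

lemma map_mat_derivation_mult:
  assumes d: "derivation d" and "A \<in> carrier_mat n m" "B \<in> carrier_mat m k"
  shows "map_mat d (A * B) = map_mat d A * B + A * map_mat d B"
  using assms(2,3)
  by (intro eq_matI)
    (auto simp: scalar_prod_def derivation_sum[OF d] derivationD[OF d] sum.distrib)

text \<open>
  If \<open>\<phi>\<close> is conjugation by \<open>G\<close>, compatibility with the derivations says that
  \<open>inverse G * G' - P\<close> commutes with every matrix.
\<close>

lemma splitting_solution:
  fixes d :: "'a :: field \<Rightarrow> 'a"
  assumes d: "derivation d" and n: "n > 0" and P: "P \<in> carrier_mat n n"
    and split: "diff_mat_algebra_isomorphic n (mat_derivation d P) (map_mat d)"
  obtains G c where "G \<in> carrier_mat n n" "det G \<noteq> 0" "map_mat d G = G * (P + c \<cdot>\<^sub>m 1\<^sub>m n)"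
proof -
  obtain \<phi> where \<phi>: "mat_algebra_iso n \<phi>"
    and \<phi>d: "\<And>A. A \<in> carrier_mat n n \<Longrightarrow> \<phi> (mat_derivation d P A) = map_mat d (\<phi> A)"
    using split unfolding diff_mat_algebra_isomorphic_def by blast
  obtain G where G: "G \<in> carrier_mat n n" "det G \<noteq> 0"
    and conj: "\<And>A. A \<in> carrier_mat n n \<Longrightarrow> \<phi> A * G = G * A"
    using mat_automorphism_inner[OF \<phi> n] by blast
  obtain H where H: "H \<in> carrier_mat n n" "H * G = 1\<^sub>m n" "G * H = 1\<^sub>m n"
    using det_non_zero_imp_unit[OF G] by (auto simp: Units_def ring_mat_def)
  define G' where "G' = map_mat d G"
  have G': "G' \<in> carrier_mat n n" using G by (simp add: G'_def)
  define L where "L = H * G'"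
  have L: "L \<in> carrier_mat n n" using H G' by (simp add: L_def)
  have "(L - P) * A = A * (L - P)" if A: "A \<in> carrier_mat n n" for A
  proof -
    let ?A' = "map_mat d A"
    have A': "?A' \<in> carrier_mat n n" using A by simp
    have \<phi>A: "\<phi> A \<in> carrier_mat n n" using mat_algebra_isoD(1)[OF \<phi> A] .
    note C = A A' \<phi>A G(1) G' P H(1) L
    have DA: "mat_derivation d P A = ?A' + P * A - A * P" by (simp add: mat_derivation_def)
    have DA_carrier: "mat_derivation d P A \<in> carrier_mat n n"
      unfolding DA by (rule minus_carrier_mat[OF mult_carrier_mat[OF A P]])
    have "map_mat d (\<phi> A) * G = G * mat_derivation d P A"
      using conj[OF DA_carrier] \<phi>d[OF A] by simp
    also have "\<dots> = G * ?A' + G * (P * A) - G * (A * P)"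
      using C by (simp add: DA mult_minus_distrib_mat[of _ n n _ n] mult_add_distrib_mat[of _ n n _ n])
    finally have 1: "map_mat d (\<phi> A) * G = G * ?A' + G * (P * A) - G * (A * P)" .
    have "map_mat d (\<phi> A) * G + \<phi> A * G' = map_mat d (G * A)"
      unfolding G'_def conj[OF A, symmetric] using C by (intro map_mat_derivation_mult[OF d, symmetric])
    also have "\<dots> = G' * A + G * ?A'"
      unfolding G'_def using C by (intro map_mat_derivation_mult[OF d])
    finally have 2: "G * ?A' + G * (P * A) - G * (A * P) + \<phi> A * G' = G' * A + G * ?A'"
      unfolding 1 .
    have 3: "G * (P * A) - G * (A * P) + \<phi> A * G' = G' * A"
    proof (rule eq_matI)
      fix i j assume ij: "i < dim_row (G' * A)" "j < dim_col (G' * A)"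
      have "(G * ?A' + G * (P * A) - G * (A * P) + \<phi> A * G') $$ (i, j) = (G' * A + G * ?A') $$ (i, j)"
        by (simp only: 2)
      then show "(G * (P * A) - G * (A * P) + \<phi> A * G') $$ (i, j) = (G' * A) $$ (i, j)"
        using C ij by (simp del: index_mult_mat(1) add: algebra_simps)
    qed (use C in simp_all)
    have "\<phi> A = \<phi> A * (G * H)" using C H(3) by simp
    also have "\<dots> = \<phi> A * G * H"
      using C by (intro assoc_mult_mat[symmetric, of _ n n _ n _ n]) auto
    also have "\<phi> A * G = G * A" by (rule conj[OF A])
    finally have "H * (\<phi> A * G') = H * (G * A * H * G')" by simp
    also have "G * A * H * G' = G * (A * L)"
      using C by (simp add: L_def assoc_mult_mat[of _ n n _ n _ n])
    also have "H * (G * (A * L)) = H * G * (A * L)"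
      using C by (intro assoc_mult_mat[symmetric, of _ n n _ n _ n]) auto
    also have "\<dots> = A * L" using C H(2) by simp
    finally have 4: "H * (\<phi> A * G') = A * L" .
    have HG: "H * (G * B) = B" if "B \<in> carrier_mat n n" for B
      using assoc_mult_mat[OF H(1) G(1) that] H(2) that by simp
    have "L * A = H * (G' * A)"
      unfolding L_def using C by (intro assoc_mult_mat) auto
    also have "\<dots> = H * (G * (P * A)) - H * (G * (A * P)) + H * (\<phi> A * G')"
      unfolding 3[symmetric]
      using C minus_carrier_mat[of "G * (A * P)" n n "G * (P * A)"]
      by (simp add: mult_minus_distrib_mat[of _ n n _ n] mult_add_distrib_mat[of _ n n _ n])
    also have "\<dots> = P * A - A * P + A * L"
      unfolding 4 using C by (simp add: HG)
    finally have LA: "L * A = P * A - A * P + A * L" .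
    have "(L - P) * A = L * A - P * A" using C by (intro minus_mult_distrib_mat) auto
    also have "\<dots> = A * L - A * P"
      unfolding LA using C by (intro eq_matI) (simp_all del: index_mult_mat(1) add: index_mult_mat(2,3))
    also have "\<dots> = A * (L - P)" using C by (intro mult_minus_distrib_mat[symmetric]) auto
    finally show ?thesis .
  qed
  then obtain c where c: "L - P = c \<cdot>\<^sub>m 1\<^sub>m n"
    using commutes_with_all_imp_scalar[OF minus_carrier_mat[OF P] n, of L] by blast
  have "L = P + c \<cdot>\<^sub>m 1\<^sub>m n"
    unfolding c[symmetric] using L P by (intro eq_matI) auto
  moreover have "G * L = G'"
    unfolding L_def using assoc_mult_mat[OF G(1) H(1) G'] H(3) G' by simp
  ultimately show ?thesis using that[OF G, of c] by (simp add: G'_def)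
qed

section \<open>The derivative of the determinant\<close>

lemma prod_dual_one:
  "finite I \<Longrightarrow> (\<Prod>i\<in>I. Dual 1 (f i)) = Dual 1 (\<Sum>i\<in>I. f i :: 'a :: comm_ring_1)"
  by (induction I rule: finite_induct) (simp_all add: dual_eq_iff algebra_simps)

text \<open>
  In the Leibniz formula a permutation other than the identity moves at least two points, so it
  contributes a product with two factors from \<open>\<epsilon> Q\<close>, and \<open>\<epsilon>\<^sup>2 = 0\<close>.
\<close>

lemma det_dual_one_plus:
  fixes Q :: "'a :: comm_ring_1 mat"
  assumes "Q \<in> carrier_mat n n"
  shows "det (mat n n (\<lambda>(i, j). Dual (if i = j then 1 else 0) (Q $$ (i, j)))) = Dual 1 (mat_trace Q)"
proof -
  define A where "A = mat n n (\<lambda>(i, j). Dual (if i = j then 1 else 0) (Q $$ (i, j)))"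
  let ?S = "{p. p permutes {0..<n}}"
  let ?t = "\<lambda>p. signof p * (\<Prod>i = 0..<n. A $$ (i, p i))"
  have zero: "?t p = 0" if p: "p permutes {0..<n}" "p \<noteq> id" for p
  proof -
    obtain i where i: "p i \<noteq> i" using p(2) by (auto simp: fun_eq_iff)
    then have i_n: "i \<in> {0..<n}" using p(1) by (metis permutes_def)
    let ?j = "p i"
    have j_n: "?j \<in> {0..<n}" "p ?j \<in> {0..<n}" using i_n p(1) permutes_in_image[OF p(1)] by auto
    have j: "p ?j \<noteq> ?j" using i permutes_inj[OF p(1)] by (metis injD)
    have "(\<Prod>i = 0..<n. A $$ (i, p i)) =
        A $$ (i, p i) * (A $$ (?j, p ?j) * (\<Prod>k\<in>{0..<n} - {i} - {?j}. A $$ (k, p k)))"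
      using i i_n j_n by (simp add: prod.remove[of _ i] prod.remove[of _ ?j])
    also have "\<dots> = A $$ (i, p i) * A $$ (?j, p ?j) * (\<Prod>k\<in>{0..<n} - {i} - {?j}. A $$ (k, p k))"
      by (simp add: mult.assoc)
    also have "A $$ (i, p i) * A $$ (?j, p ?j) = 0"
      using i j i_n j_n by (simp add: A_def dual_eq_iff)
    finally show ?thesis by simp
  qed
  have "det A = (\<Sum>p\<in>?S. ?t p)"
    unfolding det_def by (simp add: A_def)
  also have "\<dots> = (\<Sum>p\<in>{id}. ?t p)"
    using zero by (intro sum.mono_neutral_right) (auto simp: finite_permutations permutes_id)
  also have "\<dots> = (\<Prod>i = 0..<n. Dual 1 (Q $$ (i, i)))"
    by (simp add: A_def)
  also have "\<dots> = Dual 1 (mat_trace Q)"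
    using assms by (simp add: prod_dual_one mat_trace_def atLeast0LessThan)
  finally show ?thesis by (simp add: A_def)
qed

lemma im_sum: "im (sum f I) = (\<Sum>i\<in>I. im (f i :: 'a :: comm_ring_1 dual))"
  by (induction I rule: infinite_finite_induct) simp_all

text \<open>
  The homomorphism \<open>x \<mapsto> x + d x \<epsilon>\<close> commutes with determinants, and it sends \<open>G\<close> to \<open>G (1 + \<epsilon> Q)\<close>.
\<close>

lemma derivation_det:
  fixes d :: "'a :: field \<Rightarrow> 'a"
  assumes d: "derivation d" and G: "G \<in> carrier_mat n n" and Q: "Q \<in> carrier_mat n n"
    and eq: "map_mat d G = G * Q"
  shows "d (det G) = mat_trace Q * det G"
proof -
  define s where "s x = Dual x (d x)" for x
  define k :: "'a \<Rightarrow> 'a dual" where "k x = Dual x 0" for x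
  interpret s: comm_ring_hom s
    by unfold_locales (simp_all add: s_def dual_eq_iff derivationD[OF d])
  interpret k: comm_ring_hom k
    by unfold_locales (simp_all add: k_def dual_eq_iff)
  define E where "E = mat n n (\<lambda>(i, j). Dual (if i = j then 1 else 0) (Q $$ (i, j)))"
  have "map_mat s G = map_mat k G * E"
  proof (rule eq_matI)
    fix i j assume ij: "i < dim_row (map_mat k G * E)" "j < dim_col (map_mat k G * E)"
    then have ij': "i < n" "j < n" using G by (simp_all add: E_def)
    have "d (G $$ (i, j)) = (G * Q) $$ (i, j)"
      using eq ij' G by (metis carrier_matD index_map_mat(1))
    then show "map_mat s G $$ (i, j) = (map_mat k G * E) $$ (i, j)"
      using ij' G Q
      by (simp add: s_def k_def E_def scalar_prod_def dual_eq_iff re_hom.hom_sum im_sum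
          if_distrib[of "\<lambda>c. _ * c"] cong: if_cong)
  qed (use G in \<open>simp_all add: E_def\<close>)
  then have "det (map_mat s G) = det (map_mat k G) * det E"
    using det_mult[of "map_mat k G" n E] G by (simp add: E_def)
  moreover have "det E = Dual 1 (mat_trace Q)"
    unfolding E_def by (rule det_dual_one_plus[OF Q])
  ultimately have "s (det G) = k (det G) * Dual 1 (mat_trace Q)"
    by (simp only: s.hom_det k.hom_det)
  then show ?thesis by (simp add: s_def k_def dual_eq_iff mult.commute)
qed

lemma map_vec_solution:
  fixes d :: "'a :: field \<Rightarrow> 'a" and w :: "'a vec"
  assumes d: "derivation d" and G: "G \<in> carrier_mat n n" and Q: "Q \<in> carrier_mat n n"
    and eq: "map_mat d G = G * Q" and w: "w \<in> carrier_vec n" "\<And>j. j < n \<Longrightarrow> d (w $ j) = 0"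
  shows "map_vec d (G *\<^sub>v w) = G *\<^sub>v (Q *\<^sub>v w)"
proof -
  have "map_vec d (G *\<^sub>v w) = map_mat d G *\<^sub>v w"
    using G w by (intro eq_vecI) (auto simp: scalar_prod_def derivation_sum[OF d] derivationD[OF d])
  then show ?thesis using eq assoc_mult_mat_vec[OF G Q w(1)] by simp
qed

section \<open>Generalised eigenvectors of non-diagonalizable matrices\<close>

text \<open>
  The columns of \<open>B\<close> are \<open>m\<close> linearly independent eigenvectors of \<open>A\<close> with eigenvalues \<open>\<mu> j\<close>.  Both
  conditions are phrased through the linear combinations \<open>B x\<close>, the form in which they are used.
\<close>

definition eigen_frame :: "nat \<Rightarrow> 'a :: field mat \<Rightarrow> nat \<Rightarrow> 'a mat \<Rightarrow> (nat \<Rightarrow> 'a) \<Rightarrow> bool" where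
  "eigen_frame n A m B \<mu> \<longleftrightarrow> B \<in> carrier_mat n m \<and>
     (\<forall>x\<in>carrier_vec m. B *\<^sub>v x = 0\<^sub>v n \<longrightarrow> x = 0\<^sub>v m) \<and>
     (\<forall>x\<in>carrier_vec m. A *\<^sub>v (B *\<^sub>v x) = B *\<^sub>v vec m (\<lambda>j. \<mu> j * x $ j))"

lemma wide_matrix_kernel:
  fixes A :: "'a :: field mat"
  assumes "A \<in> carrier_mat n m" "n < m"
  obtains x where "x \<in> carrier_vec m" "x \<noteq> 0\<^sub>v m" "A *\<^sub>v x = 0\<^sub>v n"
proof -
  have "\<exists>c. (\<exists>j\<in>{0..<m}. c j \<noteq> 0) \<and> (\<forall>i\<in>{0..<n}. (\<Sum>j\<in>{0..<m}. c j * A $$ (i, j)) = 0)"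
    using assms(2) by (intro homogeneous_system) simp_all
  then obtain c where c: "\<exists>j\<in>{0..<m}. c j \<noteq> 0"
    "\<forall>i\<in>{0..<n}. (\<Sum>j\<in>{0..<m}. c j * A $$ (i, j)) = 0"
    by blast
  show ?thesis
  proof
    show "vec m c \<in> carrier_vec m" by simp
    show "vec m c \<noteq> 0\<^sub>v m"
    proof
      assume z: "vec m c = 0\<^sub>v m"
      from c(1) obtain j where j: "j < m" "c j \<noteq> 0" by auto
      have "vec m c $ j = 0" unfolding z using j(1) by simp
      then show False using j by simp
    qed
    show "A *\<^sub>v vec m c = 0\<^sub>v n"
      using assms(1) c(2) by (intro eq_vecI) (auto simp: scalar_prod_def mult.commute)
  qed
qed

text \<open>
  The initial term of \<open>f\<close> in the shift operator, applied to the sequence \<open>s\<close>.  If \<open>s i\<close> is a coordinate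
  of \<open>A\<^sup>i u\<close>, this is the same coordinate of \<open>f(A) u\<close>.
\<close>

definition poly_seq :: "'a :: comm_ring_1 poly \<Rightarrow> (nat \<Rightarrow> 'a) \<Rightarrow> 'a" where
  "poly_seq f s = (\<Sum>i\<le>degree f. coeff f i * s i)"

lemma poly_seq_bound: "degree f \<le> N \<Longrightarrow> poly_seq f s = (\<Sum>i\<le>N. coeff f i * s i)"
  unfolding poly_seq_def by (intro sum.mono_neutral_left) (auto simp: coeff_eq_0)

lemma poly_seq_linear_factor:
  "poly_seq ([:- a, 1:] * f) s = poly_seq f (\<lambda>i. s (Suc i) - a * s i)"
proof -
  have "degree ([:- a, 1:] * f) \<le> Suc (degree f)"
    using degree_mult_le[of "[:- a, 1:]" f] by simp
  then have "poly_seq ([:- a, 1:] * f) s =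
      (\<Sum>i\<le>Suc (degree f). coeff (pCons 0 f) i * s i) - a * (\<Sum>i\<le>Suc (degree f). coeff f i * s i)"
    by (simp add: poly_seq_bound algebra_simps sum_subtractf sum_distrib_left del: sum.atMost_Suc)
  also have "(\<Sum>i\<le>Suc (degree f). coeff (pCons 0 f) i * s i) = (\<Sum>i\<le>degree f. coeff f i * s (Suc i))"
    by (subst sum.atMost_Suc_shift) simp
  also have "(\<Sum>i\<le>Suc (degree f). coeff f i * s i) = (\<Sum>i\<le>degree f. coeff f i * s i)"
    by (simp add: coeff_eq_0)
  finally show ?thesis
    by (simp add: poly_seq_def algebra_simps sum_subtractf sum_distrib_left)
qed

lemma mat_powers_commute:
  fixes A :: "'a :: field mat"
  assumes "A \<in> carrier_mat n n" "u \<in> carrier_vec n"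
  shows "((*\<^sub>v) A ^^ i) u \<in> carrier_vec n"
    "((*\<^sub>v) A ^^ i) (A *\<^sub>v u - a \<cdot>\<^sub>v u) = ((*\<^sub>v) A ^^ Suc i) u - a \<cdot>\<^sub>v ((*\<^sub>v) A ^^ i) u"
proof -
  show *: "((*\<^sub>v) A ^^ i) u \<in> carrier_vec n" for i
    by (induction i) (use assms in auto)
  show "((*\<^sub>v) A ^^ i) (A *\<^sub>v u - a \<cdot>\<^sub>v u) = ((*\<^sub>v) A ^^ Suc i) u - a \<cdot>\<^sub>v ((*\<^sub>v) A ^^ i) u"
  proof (induction i)
    case (Suc i)
    let ?x = "((*\<^sub>v) A ^^ i) u"
    have "A *\<^sub>v (A *\<^sub>v ?x - a \<cdot>\<^sub>v ?x) = A *\<^sub>v (A *\<^sub>v ?x) - A *\<^sub>v (a \<cdot>\<^sub>v ?x)"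
      using assms(1) *[of i] by (intro mult_minus_distrib_mat_vec) auto
    also have "A *\<^sub>v (a \<cdot>\<^sub>v ?x) = a \<cdot>\<^sub>v (A *\<^sub>v ?x)" by (rule mult_mat_vec[OF assms(1) *])
    finally show ?case using Suc by simp
  qed simp
qed

text \<open>
  Some nonzero polynomial in \<open>A\<close> annihilates \<open>u\<close> because \<open>n + 1\<close> vectors are dependent.  Its linear
  factors are applied one at a time; the last vector before \<open>W\<close> is reached is an eigenvector
  modulo \<open>W\<close>.
\<close>

lemma quotient_eigenvector:
  fixes A :: "'a :: alg_closed_field mat"
  assumes A: "A \<in> carrier_mat n n" and u: "u \<in> carrier_vec n" "u \<notin> W"
    and W: "0\<^sub>v n \<in> W" "\<And>c x. x \<in> W \<Longrightarrow> c \<cdot>\<^sub>v x \<in> W"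
  obtains u' a where "u' \<in> carrier_vec n" "u' \<notin> W" "A *\<^sub>v u' - a \<cdot>\<^sub>v u' \<in> W"
proof -
  let ?s = "\<lambda>u k i. (((*\<^sub>v) A ^^ i) u) $ k"
  define act where "act f u = vec n (\<lambda>k. poly_seq f (?s u k))" for f u
  have step: "\<exists>u' a. u' \<in> carrier_vec n \<and> u' \<notin> W \<and> A *\<^sub>v u' - a \<cdot>\<^sub>v u' \<in> W"
    if "f \<noteq> 0" "u \<in> carrier_vec n" "u \<notin> W" "act f u \<in> W" for f u
    using that
  proof (induction "degree f" arbitrary: f u)
    case 0
    then obtain c where c: "f = [:c:]" "c \<noteq> 0" by (metis degree_eq_zeroE pCons_0_0)
    have "u = (1 / c) \<cdot>\<^sub>v act f u"
      using c 0(3) by (intro eq_vecI) (auto simp: act_def poly_seq_def)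
    then show ?case using W(2) 0 by metis
  next
    case (Suc m)
    obtain a where "poly f a = 0" using alg_closed_imp_poly_has_root[of f] Suc.hyps(2) by auto
    then obtain g where g: "f = [:- a, 1:] * g" by (auto simp: poly_eq_0_iff_dvd)
    then have "g \<noteq> 0" using Suc.prems(1) by auto
    then have deg: "m = degree g" using Suc.hyps(2) unfolding g by (subst (asm) degree_mult_eq) auto
    let ?u = "A *\<^sub>v u - a \<cdot>\<^sub>v u"
    have u': "?u \<in> carrier_vec n" using A Suc.prems(2) by auto
    have "act f u = act g ?u"
      unfolding act_def g
    proof (rule eq_vecI)
      fix k assume "k < dim_vec (vec n (\<lambda>k. poly_seq g (?s ?u k)))"
      then have k: "k < n" by simp
      have "?s ?u k i = ?s u k (Suc i) - a * ?s u k i" for i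
        unfolding mat_powers_commute(2)[OF A Suc.prems(2)]
        using k mat_powers_commute(1)[OF A Suc.prems(2)] by (metis carrier_vecD index_minus_vec(1) index_smult_vec)
      then show "vec n (\<lambda>k. poly_seq ([:- a, 1:] * g) (?s u k)) $ k = vec n (\<lambda>k. poly_seq g (?s ?u k)) $ k"
        using k by (simp only: index_vec poly_seq_linear_factor)
    qed simp
    then show ?case
      using Suc.hyps(1)[OF deg \<open>g \<noteq> 0\<close> u'] Suc.prems by metis
  qed
  have "\<exists>c. (\<exists>j\<in>{0..n}. c j \<noteq> 0) \<and> (\<forall>k\<in>{0..<n}. (\<Sum>j\<in>{0..n}. c j * ?s u k j) = 0)"
    by (intro homogeneous_system) simp_all
  then obtain c where c: "\<exists>j\<in>{0..n}. c j \<noteq> 0" "\<forall>k\<in>{0..<n}. (\<Sum>j\<in>{0..n}. c j * ?s u k j) = 0"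
    by blast
  define f where "f = (\<Sum>j\<in>{0..n}. monom (c j) j)"
  have coeff_f: "coeff f j = (if j \<le> n then c j else 0)" for j
    by (simp add: f_def coeff_sum)
  have "degree f \<le> n" by (rule degree_le) (simp add: coeff_f)
  then have "act f u = 0\<^sub>v n"
    using c(2) by (intro eq_vecI) (auto simp: act_def poly_seq_bound coeff_f atLeast0AtMost)
  moreover have "f \<noteq> 0" using c(1) coeff_f by (metis atLeastAtMost_iff coeff_0)
  ultimately show ?thesis using step[of f u] u W(1) that by metis
qed

lemma eigen_frame_diagonalizable:
  assumes A: "A \<in> carrier_mat n n" and B: "eigen_frame n A n B \<mu>"
  shows "diagonalizable_mat A"
proof -
  have Bc: "B \<in> carrier_mat n n" using B by (simp add: eigen_frame_def)
  have "det B \<noteq> 0"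
    using B det_0_iff_vec_prod_zero_field[OF Bc] by (auto simp: eigen_frame_def)
  then obtain C where C: "C \<in> carrier_mat n n" "C * B = 1\<^sub>m n" "B * C = 1\<^sub>m n"
    using det_non_zero_imp_unit[OF Bc] by (auto simp: Units_def ring_mat_def)
  define D where "D = mat n n (\<lambda>(i, j). if i = j then \<mu> i else 0)"
  have D: "D \<in> carrier_mat n n" by (simp add: D_def)
  have "A * B = B * D"
  proof (rule mat_eq_by_vec)
    fix x :: "'a vec" assume x: "x \<in> carrier_vec n"
    have "D *\<^sub>v x = vec n (\<lambda>j. \<mu> j * x $ j)"
      using x by (intro eq_vecI)
        (auto simp: D_def scalar_prod_def if_distrib[of "\<lambda>c. c * _"] cong: if_cong)
    then show "A * B *\<^sub>v x = B * D *\<^sub>v x"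
      using B x assoc_mult_mat_vec[OF A Bc x] assoc_mult_mat_vec[OF Bc D x]
      by (simp add: eigen_frame_def)
  qed (use A Bc D in auto)
  then have "A = B * D * C"
    using A Bc C(1,3) assoc_mult_mat[OF A Bc C(1)] by simp
  then have "similar_mat A D"
    unfolding similar_mat_def similar_mat_wit_def using A Bc C D
    by (intro exI[of _ B] exI[of _ C]) (simp add: Let_def)
  moreover have "diagonal_mat D" by (simp add: diagonal_mat_def D_def)
  ultimately show ?thesis unfolding diagonalizable_mat_def by blast
qed

lemma eigen_frame_extend:
  assumes A: "A \<in> carrier_mat n n" and B: "eigen_frame n A m B \<mu>"
    and u: "u \<in> carrier_vec n" "A *\<^sub>v u = a \<cdot>\<^sub>v u"
    and new: "\<And>x. x \<in> carrier_vec m \<Longrightarrow> B *\<^sub>v x \<noteq> u"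
  shows "\<exists>B' \<mu>'. eigen_frame n A (Suc m) B' \<mu>'"
proof -
  have Bc: "B \<in> carrier_mat n m" using B by (simp add: eigen_frame_def)
  define B' where "B' = mat n (Suc m) (\<lambda>(i, j). if j < m then B $$ (i, j) else u $ i)"
  define \<mu>' where "\<mu>' j = (if j < m then \<mu> j else a)" for j
  let ?cut = "\<lambda>x :: 'a vec. vec m (\<lambda>j. x $ j)"
  have B'_mult: "B' *\<^sub>v x = B *\<^sub>v ?cut x + x $ m \<cdot>\<^sub>v u" if "x \<in> carrier_vec (Suc m)" for x
    using that Bc u(1) by (intro eq_vecI) (auto simp: B'_def scalar_prod_def mult.commute)
  have "x = 0\<^sub>v (Suc m)" if x: "x \<in> carrier_vec (Suc m)" "B' *\<^sub>v x = 0\<^sub>v n" for x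
  proof -
    have sum0: "B *\<^sub>v ?cut x + x $ m \<cdot>\<^sub>v u = 0\<^sub>v n" using x B'_mult by simp
    have xm: "x $ m = 0"
    proof (rule ccontr)
      assume nz: "x $ m \<noteq> 0"
      let ?y = "(- 1 / x $ m) \<cdot>\<^sub>v ?cut x"
      have "B *\<^sub>v ?y = (- 1 / x $ m) \<cdot>\<^sub>v (B *\<^sub>v ?cut x)"
        using Bc by (intro mult_mat_vec) auto
      also have "\<dots> = u"
      proof (rule eq_vecI)
        fix i assume "i < dim_vec u"
        then have i: "i < n" using u by simp
        have "(B *\<^sub>v ?cut x + x $ m \<cdot>\<^sub>v u) $ i = 0" using sum0 i by simp
        then have "(B *\<^sub>v ?cut x) $ i = - (x $ m * u $ i)"
          using i u(1) Bc by (simp add: eq_neg_iff_add_eq_0)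
        then show "((- 1 / x $ m) \<cdot>\<^sub>v (B *\<^sub>v ?cut x)) $ i = u $ i"
          using i Bc nz by simp
      qed (use u Bc in simp)
      finally show False using new[of ?y] by simp
    qed
    have "B *\<^sub>v ?cut x = 0\<^sub>v n"
    proof (rule eq_vecI)
      fix i assume i: "i < dim_vec (0\<^sub>v n :: 'a vec)"
      then have "(B *\<^sub>v ?cut x + x $ m \<cdot>\<^sub>v u) $ i = 0" using sum0 by simp
      then show "(B *\<^sub>v ?cut x) $ i = (0\<^sub>v n :: 'a vec) $ i" using i u(1) xm by simp
    qed (use Bc in simp)
    then have "?cut x = 0\<^sub>v m" using B by (simp add: eigen_frame_def)
    then have "x $ j = 0" if "j < m" for j using that by (metis index_vec index_zero_vec(1))
    then show ?thesis using x(1) xm by (intro eq_vecI) (auto simp: less_Suc_eq)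
  qed
  moreover have "A *\<^sub>v (B' *\<^sub>v x) = B' *\<^sub>v vec (Suc m) (\<lambda>j. \<mu>' j * x $ j)"
    if x: "x \<in> carrier_vec (Suc m)" for x
  proof -
    have "A *\<^sub>v (B' *\<^sub>v x) = A *\<^sub>v (B *\<^sub>v ?cut x) + A *\<^sub>v (x $ m \<cdot>\<^sub>v u)"
      unfolding B'_mult[OF x] using A Bc u(1) by (intro mult_add_distrib_mat_vec) auto
    also have "A *\<^sub>v (x $ m \<cdot>\<^sub>v u) = (a * x $ m) \<cdot>\<^sub>v u"
      using A u by (simp add: mult_mat_vec smult_smult_assoc mult.commute)
    also have "A *\<^sub>v (B *\<^sub>v ?cut x) = B *\<^sub>v vec m (\<lambda>j. \<mu> j * ?cut x $ j)"
      using B by (simp add: eigen_frame_def)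
    also have "vec m (\<lambda>j. \<mu> j * ?cut x $ j) = ?cut (vec (Suc m) (\<lambda>j. \<mu>' j * x $ j))"
      by (intro eq_vecI) (auto simp: \<mu>'_def)
    finally show ?thesis
      by (subst B'_mult) (simp_all add: \<mu>'_def)
  qed
  ultimately have "eigen_frame n A (Suc m) B' \<mu>'"
    by (simp add: eigen_frame_def B'_def)
  then show ?thesis by blast
qed

text \<open>
  The span \<open>W\<close> of a largest family of independent eigenvectors is not the whole space.  An
  eigenvector modulo \<open>W\<close> can be corrected by an element of \<open>W\<close> so that only its own eigenvalue
  remains on the right-hand side, and this remainder is nonzero because the family is maximal.
\<close>

lemma not_diagonalizable_gen_eigenvector:
  fixes A :: "'a :: alg_closed_field mat"
  assumes A: "A \<in> carrier_mat n n" and "\<not> diagonalizable_mat A"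
  obtains a v w where "v \<in> carrier_vec n" "w \<in> carrier_vec n" "w \<noteq> 0\<^sub>v n"
    "A *\<^sub>v v = a \<cdot>\<^sub>v v + w" "A *\<^sub>v w = a \<cdot>\<^sub>v w"
proof -
  let ?P = "\<lambda>m. \<exists>B \<mu>. eigen_frame n A m B \<mu>"
  have le: "m \<le> n" if frame: "eigen_frame n A m B \<mu>" for m B \<mu>
  proof (rule ccontr)
    assume "\<not> m \<le> n"
    then have "n < m" by simp
    moreover have "B \<in> carrier_mat n m" using frame by (simp add: eigen_frame_def)
    ultimately obtain x where "x \<in> carrier_vec m" "x \<noteq> 0\<^sub>v m" "B *\<^sub>v x = 0\<^sub>v n"
      using wide_matrix_kernel by blast
    then show False using frame by (auto simp: eigen_frame_def)
  qed
  have "eigen_frame n A 0 (0\<^sub>m n 0) (\<lambda>_. 0)"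
  proof -
    have "(0\<^sub>m n 0 :: 'a mat) *\<^sub>v x = 0\<^sub>v n" if "x \<in> carrier_vec 0" for x
      using that by (intro eq_vecI) (auto simp: scalar_prod_def)
    moreover have "A *\<^sub>v 0\<^sub>v n = 0\<^sub>v n"
      using A by (intro eq_vecI) auto
    moreover have "x = 0\<^sub>v 0" if "x \<in> carrier_vec 0" for x :: "'a vec"
      using that by auto
    ultimately show ?thesis by (simp add: eigen_frame_def)
  qed
  then have "?P 0" by blast
  moreover have "\<forall>k. ?P k \<longrightarrow> k < Suc n" using le by (auto simp: less_Suc_eq_le)
  ultimately obtain m where "?P m" and max: "\<forall>k. ?P k \<longrightarrow> k \<le> m"
    using ex_has_greatest_nat[of ?P 0 "\<lambda>k. k" "Suc n"] by blast
  from \<open>?P m\<close> obtain B \<mu> where B: "eigen_frame n A m B \<mu>" by blast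
  have Bc: "B \<in> carrier_mat n m" using B by (simp add: eigen_frame_def)
  have "m \<noteq> n" using B eigen_frame_diagonalizable[OF A] assms(2) by blast
  then have "m < n" using le[OF B] by simp
  define W where "W = {B *\<^sub>v x | x. x \<in> carrier_vec m}"
  have W_I: "B *\<^sub>v x \<in> W" if "x \<in> carrier_vec m" for x using that by (auto simp: W_def)
  have "\<exists>u0\<in>carrier_vec n. u0 \<notin> W"
  proof (rule ccontr)
    assume "\<not> ?thesis"
    then have "\<forall>j<n. \<exists>x. x \<in> carrier_vec m \<and> unit_vec n j = B *\<^sub>v x" by (auto simp: W_def)
    then obtain x where x: "\<And>j. j < n \<Longrightarrow> x j \<in> carrier_vec m" "\<And>j. j < n \<Longrightarrow> unit_vec n j = B *\<^sub>v x j"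
      by metis
    define T where "T = mat m n (\<lambda>(i, j). x j $ i)"
    have T: "T \<in> carrier_mat m n" by (simp add: T_def)
    have "B * T = 1\<^sub>m n"
    proof (rule eq_matI)
      fix i j assume ij: "i < dim_row (1\<^sub>m n :: 'a mat)" "j < dim_col (1\<^sub>m n :: 'a mat)"
      then have "col T j = x j"
        using carrier_vecD[OF x(1), of j] by (intro eq_vecI) (simp_all add: T_def)
      then have "(B * T) $$ (i, j) = (B *\<^sub>v x j) $ i" using ij Bc T by simp
      also have "\<dots> = (unit_vec n j :: 'a vec) $ i" using x(2)[of j] ij by simp
      finally show "(B * T) $$ (i, j) = (1\<^sub>m n :: 'a mat) $$ (i, j)" using ij by simp
    qed (use Bc T in auto)
    moreover obtain y where y: "y \<in> carrier_vec n" "y \<noteq> 0\<^sub>v n" "T *\<^sub>v y = 0\<^sub>v m"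
      using wide_matrix_kernel[OF T \<open>m < n\<close>] by blast
    ultimately have "y = B *\<^sub>v 0\<^sub>v m"
      using assoc_mult_mat_vec[OF Bc T y(1)] by simp
    also have "\<dots> = 0\<^sub>v n" using Bc by (intro eq_vecI) auto
    finally show False using y(2) by simp
  qed
  moreover have "0\<^sub>v n \<in> W"
  proof -
    have "B *\<^sub>v 0\<^sub>v m = 0\<^sub>v n" using Bc by (intro eq_vecI) auto
    then show ?thesis using W_I[of "0\<^sub>v m"] by simp
  qed
  moreover have "c \<cdot>\<^sub>v x \<in> W" if "x \<in> W" for c x
  proof -
    obtain y where y: "y \<in> carrier_vec m" "x = B *\<^sub>v y" using \<open>x \<in> W\<close> by (auto simp: W_def)
    then show ?thesis using W_I[of "c \<cdot>\<^sub>v y"] Bc by (simp add: mult_mat_vec)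
  qed
  ultimately obtain u a where u: "u \<in> carrier_vec n" "u \<notin> W" "A *\<^sub>v u - a \<cdot>\<^sub>v u \<in> W"
    using quotient_eigenvector[OF A] by metis
  then obtain x where x: "x \<in> carrier_vec m" "A *\<^sub>v u - a \<cdot>\<^sub>v u = B *\<^sub>v x"
    by (auto simp: W_def)
  \<comment> \<open>Subtracting a vector of the frame removes from \<open>B x\<close> the components of the eigenvalues
    other than \<open>a\<close>.\<close>
  define y where "y = vec m (\<lambda>j. if \<mu> j = a then 0 else x $ j / (\<mu> j - a))"
  define r where "r = vec m (\<lambda>j. if \<mu> j = a then x $ j else 0)"
  have y: "y \<in> carrier_vec m" and r: "r \<in> carrier_vec m" by (simp_all add: y_def r_def)
  define v where "v = u - B *\<^sub>v y"
  define w where "w = B *\<^sub>v r"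
  have v: "v \<in> carrier_vec n" and w: "w \<in> carrier_vec n"
    using u(1) Bc y r by (simp_all add: v_def w_def)
  have Aw: "A *\<^sub>v w = a \<cdot>\<^sub>v w"
  proof -
    have "A *\<^sub>v w = B *\<^sub>v vec m (\<lambda>j. \<mu> j * r $ j)"
      using B r by (simp add: eigen_frame_def w_def)
    also have "vec m (\<lambda>j. \<mu> j * r $ j) = a \<cdot>\<^sub>v r" by (intro eq_vecI) (auto simp: r_def)
    also have "B *\<^sub>v (a \<cdot>\<^sub>v r) = a \<cdot>\<^sub>v w" using Bc r by (simp add: mult_mat_vec w_def)
    finally show ?thesis .
  qed
  have Av: "A *\<^sub>v v = a \<cdot>\<^sub>v v + w"
  proof -
    let ?z = "vec m (\<lambda>j. \<mu> j * y $ j)"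
    have "A *\<^sub>v v = A *\<^sub>v u - A *\<^sub>v (B *\<^sub>v y)"
      unfolding v_def using A u(1) Bc y by (intro mult_minus_distrib_mat_vec) auto
    also have "A *\<^sub>v (B *\<^sub>v y) = B *\<^sub>v ?z" using B y by (simp add: eigen_frame_def)
    also have "?z = a \<cdot>\<^sub>v y + (x - r)"
      using x(1) by (intro eq_vecI) (auto simp: y_def r_def field_simps)
    also have "B *\<^sub>v (a \<cdot>\<^sub>v y + (x - r)) = a \<cdot>\<^sub>v (B *\<^sub>v y) + (B *\<^sub>v x - w)"
      using Bc x(1) y r
      by (simp add: mult_add_distrib_mat_vec[of _ n m] mult_minus_distrib_mat_vec[of _ n m] mult_mat_vec w_def)
    also have "A *\<^sub>v u - (a \<cdot>\<^sub>v (B *\<^sub>v y) + (B *\<^sub>v x - w)) = a \<cdot>\<^sub>v v + w"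
      unfolding x(2)[symmetric] v_def
      using A u(1) Bc y w by (intro eq_vecI) (auto simp: algebra_simps simp del: index_mult_mat_vec)
    finally show ?thesis .
  qed
  have "w \<noteq> 0\<^sub>v n"
  proof
    assume "w = 0\<^sub>v n"
    then have "A *\<^sub>v v = a \<cdot>\<^sub>v v" using Av v by simp
    moreover have "B *\<^sub>v z \<noteq> v" if z: "z \<in> carrier_vec m" for z
    proof
      assume eq: "B *\<^sub>v z = v"
      have "B *\<^sub>v (z + y) = v + B *\<^sub>v y"
        using Bc z y by (simp add: mult_add_distrib_mat_vec[of _ n m] eq)
      also have "\<dots> = u" unfolding v_def using u(1) Bc y by (intro eq_vecI) auto
      finally show False using W_I[of "z + y"] z y u(2) by simp
    qed
    ultimately show False
      using eigen_frame_extend[OF A B v, of a] max by (metis Suc_n_not_le_n)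
  qed
  then show ?thesis using that[OF v w _ Av Aw] by blast
qed

section \<open>Linear solutions in the algebraic closure\<close>

lemma alg_closure_derivation:
  fixes \<delta> :: "'e :: field \<Rightarrow> 'e"
  assumes \<delta>: "derivation \<delta>" and char: "CHAR('e) = 0"
  shows "\<exists>D. derivation D \<and> (\<forall>x. D (to_ac x) = to_ac (\<delta> x))"
proof -
  define e where "e x = Dual (to_ac x) (to_ac (\<delta> x))" for x
  have "subring_set (range e)"
    unfolding subring_set_def
  proof (intro conjI ballI)
    show "1 \<in> range e"
      by (rule range_eqI[of _ _ 1]) (simp add: e_def dual_eq_iff derivationD[OF \<delta>])
    fix g h assume "g \<in> range e" "h \<in> range e"
    then obtain x y where "g = e x" "h = e y" by blast
    then have "g - h = e (x - y)" "g * h = e (x * y)"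
      by (simp_all add: e_def dual_eq_iff derivationD[OF \<delta>])
    then show "g - h \<in> range e" "g * h \<in> range e" by simp_all
  qed
  moreover have "g = 0" if "g \<in> range e" "re g = 0" for g
    using that by (auto simp: e_def dual_eq_iff derivationD[OF \<delta>])
  ultimately obtain D where "derivation D" "\<forall>g\<in>range e. D (re g) = im g"
    using derivation_extension[of "range e"] char by auto
  then show ?thesis by (intro exI[of _ D]) (simp add: e_def)
qed

lemma exists_nonzero_coordinate:
  assumes "G \<in> carrier_mat n n" "det (G :: 'a :: field mat) \<noteq> 0" "w \<in> carrier_vec n" "w \<noteq> 0\<^sub>v n"
  obtains i where "i < n" "(G *\<^sub>v w) $ i \<noteq> 0"
proof -
  have "G *\<^sub>v w \<noteq> 0\<^sub>v n" using det_0_iff_vec_prod_zero_field[OF assms(1)] assms by blast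
  moreover have "G *\<^sub>v w = 0\<^sub>v n" if "\<And>i. i < n \<Longrightarrow> (G *\<^sub>v w) $ i = 0"
    using assms(1) that by (intro eq_vecI) auto
  ultimately show ?thesis using that by blast
qed

text \<open>
  The situation produced by a splitting, with the field of the entries of \<open>P\<close> embedded by \<open>\<sigma>\<close> into the
  constants of a larger differential field: \<open>G\<close> is a fundamental matrix up to the scalar \<open>c\<close>.
\<close>

locale linear_system =
  fixes D :: "'a :: field \<Rightarrow> 'a" and \<sigma> :: "'b :: field \<Rightarrow> 'a"
    and n :: nat and P :: "'b mat" and G :: "'a mat" and c :: 'a
  assumes D: "derivation D" and \<sigma>: "field_hom \<sigma>" and D_const: "\<And>x. D (\<sigma> x) = 0"
    and P: "P \<in> carrier_mat n n" and G: "G \<in> carrier_mat n n" "det G \<noteq> 0"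
    and G_eq: "map_mat D G = G * (map_mat \<sigma> P + c \<cdot>\<^sub>m 1\<^sub>m n)"
begin

sublocale \<sigma>: field_hom \<sigma> by (rule \<sigma>)

text \<open>
  With \<open>w = 0\<close> this turns an eigenvector of \<open>P\<close> into a solution of a scalar equation; with \<open>w\<close> an
  eigenvector it describes a Jordan chain of length two.
\<close>

lemma solution_entry:
  fixes v w :: "'b vec"
  assumes vw: "v \<in> carrier_vec n" "w \<in> carrier_vec n" and eq: "P *\<^sub>v v = a \<cdot>\<^sub>v v + w" and i: "i < n"
  shows "D ((G *\<^sub>v map_vec \<sigma> v) $ i) =
    (\<sigma> a + c) * (G *\<^sub>v map_vec \<sigma> v) $ i + (G *\<^sub>v map_vec \<sigma> w) $ i"
proof -
  let ?Q = "map_mat \<sigma> P + c \<cdot>\<^sub>m 1\<^sub>m n"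
  let ?v = "map_vec \<sigma> v" and ?w = "map_vec \<sigma> w"
  have Q: "?Q \<in> carrier_mat n n" using P by simp
  have v: "?v \<in> carrier_vec n" and w: "?w \<in> carrier_vec n" using vw by simp_all
  have "map_mat \<sigma> P *\<^sub>v ?v = map_vec \<sigma> (P *\<^sub>v v)"
    using \<sigma>.mult_mat_vec_hom[OF P vw(1)] by simp
  also have "\<dots> = \<sigma> a \<cdot>\<^sub>v ?v + ?w"
    unfolding eq using vw by (intro eq_vecI) (auto simp: \<sigma>.hom_add \<sigma>.hom_mult)
  finally have Pv: "map_mat \<sigma> P *\<^sub>v ?v = \<sigma> a \<cdot>\<^sub>v ?v + ?w" .
  have "?Q *\<^sub>v ?v = map_mat \<sigma> P *\<^sub>v ?v + (c \<cdot>\<^sub>m 1\<^sub>m n) *\<^sub>v ?v"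
    using P v by (intro add_mult_distrib_mat_vec) auto
  also have "(c \<cdot>\<^sub>m 1\<^sub>m n) *\<^sub>v ?v = c \<cdot>\<^sub>v ?v"
    using v by (intro eq_vecI) (auto simp: scalar_prod_left_unit)
  also have "map_mat \<sigma> P *\<^sub>v ?v + c \<cdot>\<^sub>v ?v = (\<sigma> a + c) \<cdot>\<^sub>v ?v + ?w"
    unfolding Pv using v w by (intro eq_vecI) (auto simp: algebra_simps)
  finally have "G *\<^sub>v (?Q *\<^sub>v ?v) = (\<sigma> a + c) \<cdot>\<^sub>v (G *\<^sub>v ?v) + G *\<^sub>v ?w"
    using G(1) v w by (simp add: mult_add_distrib_mat_vec[of _ n n] mult_mat_vec)
  moreover have "map_vec D (G *\<^sub>v ?v) = G *\<^sub>v (?Q *\<^sub>v ?v)"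
    using vw D_const by (intro map_vec_solution[OF D G(1) Q G_eq v]) simp
  ultimately have "map_vec D (G *\<^sub>v ?v) $ i = ((\<sigma> a + c) \<cdot>\<^sub>v (G *\<^sub>v ?v) + G *\<^sub>v ?w) $ i" by simp
  then show ?thesis using i G(1) v w by (simp del: index_mult_mat_vec)
qed

lemma sigma_nonzero_vec: "v \<in> carrier_vec n \<Longrightarrow> v \<noteq> 0\<^sub>v n \<Longrightarrow> map_vec \<sigma> v \<noteq> 0\<^sub>v n"
  for v :: "'b vec"
proof
  assume v: "v \<in> carrier_vec n" "v \<noteq> 0\<^sub>v n" "map_vec \<sigma> v = 0\<^sub>v n"
  have "v $ i = 0" if "i < n" for i
  proof -
    have "map_vec \<sigma> v $ i = 0" unfolding v(3) using that by simp
    then show ?thesis using that v(1) by simp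
  qed
  then show False using v(1,2) by (metis carrier_vecD eq_vecI index_zero_vec)
qed

text \<open>
  The unknown scalar \<open>c\<close> is removed with the determinant, whose logarithmic derivative is \<open>n c\<close>
  because \<open>P\<close> is traceless.
\<close>

lemma eigenvalue_weight_element:
  assumes trace: "mat_trace P = 0" and ev: "eigenvalue P a"
  shows "\<exists>u. u \<noteq> 0 \<and> D u = \<sigma> (of_nat n * a) * u"
proof -
  obtain v where v: "v \<in> carrier_vec n" "v \<noteq> 0\<^sub>v n" "P *\<^sub>v v = a \<cdot>\<^sub>v v"
    using ev P unfolding eigenvalue_def eigenvector_def by auto
  obtain i where i: "i < n" "(G *\<^sub>v map_vec \<sigma> v) $ i \<noteq> 0"
    using exists_nonzero_coordinate[OF G, of "map_vec \<sigma> v"] sigma_nonzero_vec v by auto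
  define y where "y = (G *\<^sub>v map_vec \<sigma> v) $ i"
  have "y \<noteq> 0" using i by (simp add: y_def)
  have "(G *\<^sub>v map_vec \<sigma> (0\<^sub>v n)) $ i = 0"
    using i(1) G(1) by (simp add: scalar_prod_def)
  moreover have "P *\<^sub>v v = a \<cdot>\<^sub>v v + 0\<^sub>v n" using v by simp
  ultimately have Dy: "D y = (\<sigma> a + c) * y"
    using solution_entry[OF v(1) zero_carrier_vec _ i(1)] by (simp add: y_def)
  have "mat_trace (map_mat \<sigma> P + c \<cdot>\<^sub>m 1\<^sub>m n) = \<sigma> (mat_trace P) + of_nat n * c"
    using P by (simp add: mat_trace_def sum.distrib \<sigma>.hom_sum)
  then have Ddet: "D (det G) = of_nat n * c * det G"
    using derivation_det[OF D G(1) _ G_eq] P trace by simp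
  have "D (y ^ n) = of_nat n * (\<sigma> a + c) * y ^ n"
    unfolding derivation_power[OF D] Dy by (cases n) (simp_all add: algebra_simps)
  then have "D (y ^ n / det G) = \<sigma> (of_nat n * a) * (y ^ n / det G)"
    using G(2) by (simp add: derivation_divide[OF D] Ddet \<sigma>.hom_mult \<sigma>.hom_of_nat
        field_simps power2_eq_square)
  then show ?thesis using \<open>y \<noteq> 0\<close> G(2) by (intro exI[of _ "y ^ n / det G"]) simp
qed

text \<open>
  The solutions belonging to a Jordan chain satisfy \<open>x' = m x + y\<close> and \<open>y' = m y\<close> with the same \<open>m\<close>,
  so \<open>x / y\<close> has derivative \<open>1\<close>.
\<close>

lemma gen_eigenvector_primitive:
  fixes v w :: "'b vec"
  assumes vw: "v \<in> carrier_vec n" "w \<in> carrier_vec n" "w \<noteq> 0\<^sub>v n"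
    and eq: "P *\<^sub>v v = a \<cdot>\<^sub>v v + w" "P *\<^sub>v w = a \<cdot>\<^sub>v w"
  shows "\<exists>z. D z = 1"
proof -
  obtain i where i: "i < n" "(G *\<^sub>v map_vec \<sigma> w) $ i \<noteq> 0"
    using exists_nonzero_coordinate[OF G, of "map_vec \<sigma> w"] sigma_nonzero_vec vw by auto
  define x y where "x = (G *\<^sub>v map_vec \<sigma> v) $ i" and "y = (G *\<^sub>v map_vec \<sigma> w) $ i"
  have "y \<noteq> 0" using i by (simp add: y_def)
  have "(G *\<^sub>v map_vec \<sigma> (0\<^sub>v n)) $ i = 0"
    using i(1) G(1) by (simp add: scalar_prod_def)
  moreover have "P *\<^sub>v w = a \<cdot>\<^sub>v w + 0\<^sub>v n" using vw eq by simp
  ultimately have "D y = (\<sigma> a + c) * y"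
    using solution_entry[OF vw(2) zero_carrier_vec _ i(1)] by (simp add: y_def)
  moreover have "D x = (\<sigma> a + c) * x + y"
    using solution_entry[OF vw(1,2) eq(1) i(1)] by (simp add: x_def y_def)
  ultimately have "D (x / y) = 1"
    using \<open>y \<noteq> 0\<close> by (simp add: derivation_divide[OF D] field_simps power2_eq_square)
  then show ?thesis by blast
qed

end

section \<open>Rationally independent weights\<close>

lemma derivation_ratfun_zero:
  fixes \<kappa> :: "'f :: field poly fract \<Rightarrow> 'a :: field"
  assumes d: "derivation d" and "field_hom \<kappa>"
    and const: "\<And>a. d (\<kappa> (ratfun_const a)) = 0" and var: "d (\<kappa> ratfun_var) = 0"
  shows "d (\<kappa> x) = 0"
proof -
  interpret \<kappa>: field_hom \<kappa> by fact
  have poly: "d (\<kappa> (to_fract p)) = 0" for p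
  proof (induction p)
    case (pCons a p)
    have "pCons a p = [:a:] + [:0, 1:] * p" by simp
    then have "to_fract (pCons a p) = ratfun_const a + ratfun_var * to_fract p"
      by (metis ratfun_const_def ratfun_var_def to_fract_add to_fract_mult)
    then show ?case
      using pCons const var by (simp add: \<kappa>.hom_add \<kappa>.hom_mult derivationD[OF d])
  qed (simp add: derivationD[OF d])
  obtain p q where "x = Fract p q" "q \<noteq> 0" by (cases x rule: Fract_cases)
  then have "\<kappa> x = \<kappa> (to_fract p) / \<kappa> (to_fract q)" "\<kappa> (to_fract q) \<noteq> 0"
    by (simp_all add: Fract_conv_to_fract \<kappa>.hom_div)
  then show ?thesis using poly by (simp add: derivation_divide[OF d])
qed

lemma rational_coordinate:
  fixes B :: "'b :: field_char_0 set"
  assumes B: "rat_vs.independent B" "b \<in> B"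
  shows "\<exists>\<xi> :: 'b \<Rightarrow> 'b. (\<forall>x y. \<xi> (x + y) = \<xi> x + \<xi> y) \<and> \<xi> b = 1 \<and> (\<forall>b'\<in>B. b' \<noteq> b \<longrightarrow> \<xi> b' = 0)"
proof -
  let ?E = "rat_vs.extend_basis B"
  define \<xi> :: "'b \<Rightarrow> 'b" where "\<xi> x = of_rat (rat_vs.representation ?E x b)" for x
  have E: "rat_vs.independent ?E" "rat_vs.span ?E = UNIV" "B \<subseteq> ?E"
    using B(1) by (simp_all add: rat_vs.independent_extend_basis rat_vs.extend_basis_superset)
  have "\<xi> (x + y) = \<xi> x + \<xi> y" for x y
    using E by (simp add: \<xi>_def rat_vs.representation_add of_rat_add)
  moreover have "\<xi> b' = (if b' = b then 1 else 0)" if "b' \<in> B" for b'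
    using that E by (auto simp: \<xi>_def rat_vs.representation_basis)
  ultimately show ?thesis using B(2) by (intro exI[of _ \<xi>]) auto
qed

text \<open>
  Each coordinate function of a rational basis yields a derivation of the algebraic closure acting
  on elements of weight \<open>\<sigma> m\<close> through that coordinate of \<open>m\<close>.  Away from the basis element \<open>1\<close>,
  which is the weight of \<open>t\<close>, these derivations vanish on \<open>F(t)\<close>.  An element \<open>z\<close> with \<open>D z = 1\<close> has
  generalised weight \<open>0\<close>; it is seen by the nilpotent part of \<open>D\<close>, namely the difference of \<open>D\<close> and
  the derivation that multiplies each generalised weight space by its weight.
\<close>

lemma weights_bound_trdeg:
  fixes \<iota> :: "'f :: field_char_0 poly fract \<Rightarrow> 'e :: field"
    and \<sigma> :: "'b :: field_char_0 \<Rightarrow> 'e alg_closure" and D :: "'e alg_closure \<Rightarrow> 'e alg_closure"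
  assumes char: "CHAR('e) = 0" and \<iota>: "field_hom \<iota>" and D: "derivation D"
    and \<sigma>: "field_hom \<sigma>" and D_const: "\<And>x. D (\<sigma> x) = 0"
    and D_base: "\<And>a. D (to_ac (\<iota> (ratfun_const a))) = 0"
    and D_var: "D (to_ac (\<iota> ratfun_var)) = to_ac (\<iota> ratfun_var)"
    and B: "rat_vs.independent B" "finite B" "1 \<in> B"
    and N: "N > 0" and weight: "\<And>b. b \<in> B \<Longrightarrow> b \<noteq> 1 \<Longrightarrow> \<exists>u. u \<noteq> 0 \<and> D u = \<sigma> (of_nat N * b) * u"
  shows "trdeg \<iota> \<ge> enat (card B - 1)" and "D z = 1 \<Longrightarrow> trdeg \<iota> \<ge> enat (card B)"
proof -
  interpret \<sigma>: field_hom \<sigma> by (rule \<sigma>)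
  interpret \<iota>: field_hom \<iota> by (rule \<iota>)
  let ?\<kappa> = "\<lambda>x. to_ac (\<iota> x)"
  have \<kappa>: "field_hom ?\<kappa>" by unfold_locales (simp_all add: hom_distribs)
  have char_ac: "CHAR('e alg_closure) = 0" using char by simp
  define \<Delta> where "\<Delta> \<xi> = (SOME d. derivation d \<and>
    (\<forall>m x. gen_weight D (\<sigma> m) x \<longrightarrow> d x = \<sigma> (\<xi> m) * x))" for \<xi> :: "'b \<Rightarrow> 'b"
  have \<Delta>: "derivation (\<Delta> \<xi>)" "\<And>m x. gen_weight D (\<sigma> m) x \<Longrightarrow> \<Delta> \<xi> x = \<sigma> (\<xi> m) * x"
    if "\<And>m m'. \<xi> (m + m') = \<xi> m + \<xi> m'" for \<xi> :: "'b \<Rightarrow> 'b"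
    using someI_ex[OF weight_derivation[OF D char_ac \<sigma> D_const, of \<xi>, OF that], folded \<Delta>_def]
    by blast+
  have add_zero: "\<xi> 0 = 0" if "\<And>m m'. \<xi> (m + m') = \<xi> m + \<xi> m'" for \<xi> :: "'b \<Rightarrow> 'b"
    using that[of 0 0] by (metis add.right_neutral add_left_cancel)
  have add_mult: "\<xi> (of_nat k * x) = of_nat k * \<xi> x"
    if "\<And>m m'. \<xi> (m + m') = \<xi> m + \<xi> m'" for \<xi> :: "'b \<Rightarrow> 'b" and k x
    by (induction k) (simp_all add: add_zero[OF that] that algebra_simps)
  have \<Delta>_base: "\<Delta> \<xi> (?\<kappa> (ratfun_const a)) = 0" and \<Delta>_var: "\<Delta> \<xi> (?\<kappa> ratfun_var) = \<sigma> (\<xi> 1) * ?\<kappa> ratfun_var"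
    if \<xi>: "\<And>m m'. \<xi> (m + m') = \<xi> m + \<xi> m'" for \<xi> :: "'b \<Rightarrow> 'b" and a
  proof -
    have "gen_weight D (\<sigma> 0) (?\<kappa> (ratfun_const a))"
      by (rule gen_weight_eigenvector) (simp add: D_base)
    from \<Delta>(2)[OF \<xi> this] show "\<Delta> \<xi> (?\<kappa> (ratfun_const a)) = 0"
      using add_zero[OF \<xi>] by simp
    have "gen_weight D (\<sigma> 1) (?\<kappa> ratfun_var)"
      by (rule gen_weight_eigenvector) (simp add: D_var)
    from \<Delta>(2)[OF \<xi> this] show "\<Delta> \<xi> (?\<kappa> ratfun_var) = \<sigma> (\<xi> 1) * ?\<kappa> ratfun_var" .
  qed
  obtain \<xi> where \<xi>_all: "\<forall>b\<in>B. (\<forall>x y. \<xi> b (x + y) = \<xi> b x + \<xi> b y) \<and> \<xi> b b = 1 \<and>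
      (\<forall>b'\<in>B. b' \<noteq> b \<longrightarrow> \<xi> b b' = (0 :: 'b))"
    using bchoice[of B "\<lambda>b \<xi>. (\<forall>x y. \<xi> (x + y) = \<xi> x + \<xi> y) \<and> \<xi> b = 1 \<and>
      (\<forall>b'\<in>B. b' \<noteq> b \<longrightarrow> \<xi> b' = (0 :: 'b))"] rational_coordinate[OF B(1)] by blast
  have \<xi>_add: "\<xi> b (x + y) = \<xi> b x + \<xi> b y" if "b \<in> B" for b x y using \<xi>_all that by blast
  have \<xi>_diag: "\<xi> b b = 1" if "b \<in> B" for b using \<xi>_all that by blast
  have \<xi>_off: "\<xi> b b' = 0" if "b \<in> B" "b' \<in> B" "b' \<noteq> b" for b b' using \<xi>_all that by blast
  obtain u where u: "\<And>b. b \<in> B \<Longrightarrow> b \<noteq> 1 \<Longrightarrow> u b \<noteq> 0 \<and> D (u b) = \<sigma> (of_nat N * b) * u b"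
    using weight by metis
  have u_weight: "gen_weight D (\<sigma> (of_nat N * b)) (u b)" if "b \<in> B" "b \<noteq> 1" for b
    using u[OF that] by (intro gen_weight_eigenvector) blast
  have \<Delta>_u: "\<Delta> (\<xi> b) (u b') = of_nat N * \<sigma> (\<xi> b b') * u b'" if "b \<in> B" "b' \<in> B" "b' \<noteq> 1" for b b'
    using \<Delta>(2)[OF \<xi>_add[OF that(1)] u_weight[OF that(2,3)]]
    by (simp add: add_mult[OF \<xi>_add[OF that(1)]] \<sigma>.hom_mult \<sigma>.hom_of_nat)
  have N_nz: "(of_nat N :: 'e alg_closure) \<noteq> 0"
    using N char_ac by (simp add: of_nat_eq_0_iff_char_dvd)
  have coord_derivation: "derivation (\<Delta> (\<xi> b))" if "b \<in> B" for b
    by (rule \<Delta>(1)[OF \<xi>_add[OF that]])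
  have coord_base: "\<Delta> (\<xi> b) (?\<kappa> x) = 0" if "b \<in> B" "b \<noteq> 1" for b x
    using derivation_ratfun_zero[OF coord_derivation[OF that(1)] \<kappa>]
      \<Delta>_base[OF \<xi>_add[OF that(1)]] \<Delta>_var[OF \<xi>_add[OF that(1)]] \<xi>_off[OF that(1) B(3)] that(2)
    by auto
  have coord_diag: "\<Delta> (\<xi> b) (u b) \<noteq> 0" if "b \<in> B" "b \<noteq> 1" for b
    using \<Delta>_u[OF that(1) that] \<xi>_diag[OF that(1)] u[OF that] N_nz by simp
  have coord_off: "\<Delta> (\<xi> b) (u b') = 0" if "b \<in> B" "b' \<in> B" "b' \<noteq> 1" "b \<noteq> b'" for b b'
    using \<Delta>_u[OF that(1-3)] \<xi>_off[OF that(1,2)] that(4) by simp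
  have "trdeg \<iota> \<ge> enat (card (B - {1}))"
    by (rule trdeg_ge_card_derivations[OF char \<iota>, of _ "\<lambda>b. \<Delta> (\<xi> b)" u])
      (use B coord_derivation coord_base coord_diag coord_off in auto)
  then show "trdeg \<iota> \<ge> enat (card B - 1)" using B by simp
  assume z: "D z = 1"
  have z_weight: "gen_weight D (\<sigma> 0) z"
  proof (rule gen_weight.step)
    have "gen_weight D (\<sigma> 0) 1" by (rule gen_weight_eigenvector) (simp add: derivationD[OF D])
    then show "gen_weight D (\<sigma> 0) (D z - \<sigma> 0 * z)" by (simp add: z)
  qed
  define \<nu> where "\<nu> x = D x - \<Delta> id x" for x
  have id: "derivation (\<Delta> id)" by (rule \<Delta>(1)) simp
  have \<nu>: "derivation \<nu>"
    unfolding derivation_def \<nu>_def by (simp add: derivationD[OF D] derivationD[OF id] algebra_simps)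
  have \<nu>_base: "\<nu> (?\<kappa> x) = 0" for x
    by (rule derivation_ratfun_zero[OF \<nu> \<kappa>]) (simp_all add: \<nu>_def \<Delta>_base \<Delta>_var D_base D_var)
  have \<nu>_z: "\<nu> z = 1"
    using \<Delta>(2)[of id, OF _ z_weight] by (simp add: \<nu>_def z)
  have \<nu>_u: "\<nu> (u b) = 0" if "b \<in> B" "b \<noteq> 1" for b
    using \<Delta>(2)[of id, OF _ u_weight[OF that]] u[OF that] by (simp add: \<nu>_def)
  have coord_z: "\<Delta> (\<xi> b) z = 0" if "b \<in> B" for b
    using \<Delta>(2)[OF \<xi>_add[OF that] z_weight] add_zero[OF \<xi>_add[OF that]] by simp
  show "trdeg \<iota> \<ge> enat (card B)"
  proof (rule trdeg_ge_card_derivations[OF char \<iota> B(2)])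
    let ?d = "\<lambda>b. if b = 1 then \<nu> else \<Delta> (\<xi> b)" and ?u = "\<lambda>b. if b = 1 then z else u b"
    show "derivation (?d b)" "?d b (?\<kappa> x) = 0" "?d b (?u b) \<noteq> 0" if "b \<in> B" for b x
      using that \<nu> \<nu>_base \<nu>_z coord_derivation coord_base coord_diag by auto
    show "?d b (?u b') = 0" if "b \<in> B" "b' \<in> B" "b \<noteq> b'" for b b'
      using that \<nu>_u coord_off coord_z by auto
  qed
qed

section \<open>The transcendence degree of a splitting field\<close>

theorem theorem4p6:
  fixes \<delta> :: "'f :: field_char_0 poly fract \<Rightarrow> 'f poly fract"
    and n :: nat
    and P :: "'f mat"
    and S :: "'f alg_closure set"
    and k :: nat
    and \<delta>E :: "'e :: field \<Rightarrow> 'e"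
    and \<iota> :: "'f poly fract \<Rightarrow> 'e"
  assumes "derivation \<delta>"
    and "\<delta> ratfun_var = ratfun_var"
    and "\<And>a. \<delta> (ratfun_const a) = 0"
    and "P \<in> carrier_mat n n"
    and "P \<noteq> 0\<^sub>m n n"
    and "mat_trace P = 0"
    and "S = {ev. eigenvalue (map_mat to_ac P) ev}"
    and "k = rat_vs.dim (rat_vs.span (S \<union> {1}))"
    and "diff_field_ext \<delta> \<delta>E \<iota>"
    and "splits_mat_derivation n (map_mat ratfun_const P) \<delta>E \<iota>"
  shows "(diagonalizable_mat (map_mat to_ac P) \<longrightarrow> trdeg \<iota> \<ge> enat (k - 1)) \<and>
         (\<not> diagonalizable_mat (map_mat to_ac P) \<longrightarrow> trdeg \<iota> \<ge> enat k)"
proof -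
  have \<delta>E: "derivation \<delta>E" and \<iota>: "field_hom \<iota>" and commute: "\<And>x. \<delta>E (\<iota> x) = \<iota> (\<delta> x)"
    using assms(9) by (auto simp: diff_field_ext_def)
  interpret \<iota>: field_hom \<iota> by (rule \<iota>)
  interpret const: field_hom "ratfun_const :: 'f \<Rightarrow> _"
    by unfold_locales (simp_all add: ratfun_const_def flip: to_fract_add to_fract_mult one_pCons)
  interpret ac: field_hom "to_ac :: 'e \<Rightarrow> _" by unfold_locales simp_all
  interpret acF: field_hom "to_ac :: 'f \<Rightarrow> _" by unfold_locales simp_all
  define h where "h a = to_ac (\<iota> (ratfun_const a))" for a
  have h: "field_hom h" by unfold_locales (simp_all add: h_def hom_distribs)
  interpret h: field_hom h by (rule h)
  have char: "CHAR('e) = 0"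
  proof (rule CHAR_eqI)
    fix m assume "of_nat m = (0 :: 'e)"
    then have "\<iota> (ratfun_const (of_nat m)) = 0" by (simp add: hom_distribs)
    then show "0 dvd m" by simp
  qed simp
  obtain \<sigma> :: "'f alg_closure \<Rightarrow> 'e alg_closure" where \<sigma>: "field_hom \<sigma>" "\<And>a. \<sigma> (to_ac a) = h a"
    using alg_closure_embedding[OF h] by blast
  interpret \<sigma>: field_hom \<sigma> by (rule \<sigma>)
  obtain D where D: "derivation D" and D_ac: "\<And>x. D (to_ac x) = to_ac (\<delta>E x)"
    using alg_closure_derivation[OF \<delta>E char] by blast
  have D_h: "D (h a) = 0" for a
    by (simp add: h_def D_ac commute assms(3))
  have D_var: "D (to_ac (\<iota> ratfun_var)) = to_ac (\<iota> ratfun_var)"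
    by (simp add: D_ac commute assms(2))
  \<comment> \<open>Elements algebraic over the constants of \<open>F\<close> are constants.\<close>
  have D_const: "D (\<sigma> x) = 0" for x
  proof -
    obtain p :: "'f poly" where p: "p \<noteq> 0" "poly (map_poly to_ac p) x = 0"
      using alg_closure_algebraic .
    have map: "map_poly \<sigma> (map_poly to_ac p) = map_poly h p"
      by (rule poly_eqI) (simp add: \<sigma>(2))
    have "poly (map_poly \<sigma> (map_poly to_ac p)) (\<sigma> x) = \<sigma> (poly (map_poly to_ac p) x)"
      by simp
    then have root: "poly (map_poly h p) (\<sigma> x) = 0" using p(2) map by simp
    have "map_poly h p \<noteq> 0" using p(1) by simp
    then show ?thesis
      using derivation_algebraic[OF D _ _ _ root] char D_h by simp
  qed
  have "n > 0"
  proof (rule ccontr)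
    assume "\<not> n > 0"
    then have "P = 0\<^sub>m n n" using assms(4) by (intro eq_matI) auto
    then show False using assms(5) by simp
  qed
  define Q where "Q = map_mat to_ac P"
  have Q: "Q \<in> carrier_mat n n" using assms(4) by (simp add: Q_def)
  obtain G c where G: "G \<in> carrier_mat n n" "det G \<noteq> 0"
    and G_eq: "map_mat \<delta>E G = G * (map_mat \<iota> (map_mat ratfun_const P) + c \<cdot>\<^sub>m 1\<^sub>m n)"
    using splitting_solution[OF \<delta>E \<open>n > 0\<close>, of "map_mat \<iota> (map_mat ratfun_const P)"] assms(4,10)
    unfolding splits_mat_derivation_def by auto
  let ?R = "map_mat \<iota> (map_mat ratfun_const P) + c \<cdot>\<^sub>m 1\<^sub>m n"
  have R: "map_mat to_ac ?R = map_mat \<sigma> Q + to_ac c \<cdot>\<^sub>m 1\<^sub>m n"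
    using assms(4) by (intro eq_matI) (auto simp: Q_def \<sigma>(2) h_def)
  have "map_mat D (map_mat to_ac G) = map_mat to_ac (map_mat \<delta>E G)"
    by (intro eq_matI) (auto simp: D_ac)
  also have "\<dots> = map_mat to_ac G * map_mat to_ac ?R"
    unfolding G_eq using G(1) assms(4) by (intro ac.mat_hom_mult) auto
  finally interpret linear_system D \<sigma> n Q "map_mat to_ac G" "to_ac c"
    using D \<sigma>(1) D_const Q G R by unfold_locales simp_all
  have trace: "mat_trace Q = 0"
    using assms(4,6) by (simp add: Q_def mat_trace_def flip: acF.hom_sum)
  have "finite S"
  proof -
    have "char_poly Q \<noteq> 0" using degree_monic_char_poly[OF Q] by auto
    moreover have "S = {a. poly (char_poly Q) a = 0}"
      unfolding assms(7) Q_def[symmetric] eigenvalue_root_char_poly[OF Q] ..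
    ultimately show ?thesis by (simp add: poly_roots_finite)
  qed
  \<comment> \<open>A basis of the span that contains \<open>1\<close>, the weight of \<open>t\<close>; its other elements are eigenvalues.\<close>
  have "rat_vs.independent {1 :: 'f alg_closure}"
    by (rule rat_vs.independent_insertI) (simp_all add: rat_vs.independent_empty)
  then obtain B where B: "{1} \<subseteq> B" "B \<subseteq> S \<union> {1}" "rat_vs.independent B" "S \<union> {1} \<subseteq> rat_vs.span B"
    using rat_vs.maximal_independent_subset_extend[of "{1}" "S \<union> {1}"] by auto
  have card_B: "card B = k"
    using rat_vs.basis_card_eq_dim[OF B(2,4,3)] assms(8) by simp
  have fin_B: "finite B" using B(2) \<open>finite S\<close> by (auto intro: finite_subset)
  have weight: "\<exists>u. u \<noteq> 0 \<and> D u = \<sigma> (of_nat n * b) * u" if "b \<in> B" "b \<noteq> 1" for b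
    using eigenvalue_weight_element[OF trace, of b] that B(2) assms(7) by (auto simp: Q_def)
  note bound = weights_bound_trdeg[OF char \<iota> D \<sigma>(1) D_const D_h[unfolded h_def] D_var B(3) fin_B _
      \<open>n > 0\<close> weight]
  show ?thesis
  proof (intro conjI impI)
    show "trdeg \<iota> \<ge> enat (k - 1)" using bound(1) B(1) card_B by auto
    assume "\<not> diagonalizable_mat (map_mat to_ac P)"
    then obtain a v w where "v \<in> carrier_vec n" "w \<in> carrier_vec n" "w \<noteq> 0\<^sub>v n"
      "Q *\<^sub>v v = a \<cdot>\<^sub>v v + w" "Q *\<^sub>v w = a \<cdot>\<^sub>v w"
      using not_diagonalizable_gen_eigenvector[OF Q] unfolding Q_def by metis
    then obtain z where "D z = 1" using gen_eigenvector_primitive by blast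
    then show "trdeg \<iota> \<ge> enat k" using bound(2) B(1) card_B by auto
  qed
qed

end
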